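(* Let $\gamma\in(1/2,1)$, let $x:[0,T]\to\mathbb R^{1,d}$ be $\gamma$-Hölder continuous and let $\tilde x^1\in\tilde{\mathcal C}^\gamma_{2,\gamma}([0,T];\mathbb R^{1,d})$ satisfy $\tilde\delta\tilde x^1=0$. Let $a_0\in\mathbb R^{1,m}$ and $\sigma:\mathbb R^{1,m}\to\mathbb R^{d,m}$ be of class $C^2$, bounded with bounded first and second derivatives. Then the equation $$\tilde y_0\equiv0,\qquad \tilde\delta\tilde y=\mathcal J\Big(\tilde dx\,\sigma\Big(a_0+\int_0^\infty\hat\phi(\eta)\tilde y(\eta)d\eta\Big)\Big)$$ admits a unique solution $\tilde y$ in $\tilde{\mathcal C}^{0,\gamma}_{1,\gamma}([0,T];\mathbb R^{1,m})$.
   Context: Measurable $\hat\phi:(0,\infty)\to\mathbb R$ is fixed. $\mathcal L_\gamma(V)$ is the space of measurable $g:[0,\infty)\to V$ with $\mathcal N[g;\mathcal L_\gamma]=\int_0^\infty|\hat\phi(\xi)|(1+\xi^\gamma)\|g(\xi)\|d\xi<\infty$. $\tilde{\mathcal C}_{k,\gamma}$ denotes continuous maps from $\{t_1\ge\dots\ge t_k\}\subset[0,T]^k$ into $\mathcal L_\gamma$. $(\tilde\delta f)_{ts}(\xi)=f_t(\xi)-e^{-\xi(t-s)}f_s(\xi)$ and $(\tilde\delta B)_{tus}(\xi)=B_{ts}(\xi)-B_{tu}(\xi)-e^{-\xi(t-u)}B_{us}(\xi)$. $\mathcal N[B;\tilde{\mathcal C}^\gamma_{2,\gamma}]=\sup_{s<t}\mathcal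 N[B_{ts};\mathcal L_\gamma]/|t-s|^\gamma$. $\tilde{\mathcal C}^{0,\gamma}_{1,\gamma}$ is the set of $\tilde y\in\tilde{\mathcal C}_{1,\gamma}$ with finite norm $\mathcal N[\tilde y;\tilde{\mathcal C}^{0,\gamma}_{1,\gamma}]=\sup_s\mathcal N[\tilde y_s;\mathcal L_\gamma]+\mathcal N[\tilde\delta\tilde y;\tilde{\mathcal C}^\gamma_{2,\gamma}]$. For a $\gamma$-Hölder path $z:[0,T]\to\mathbb R^{d,m}$, the Young convolutional integral is $\mathcal J_{ts}(\tilde dx\,z)=\tilde x^1_{ts}z_s+\tilde\Lambda[h]_{ts}$ with $h_{tus}=\tilde x^1_{tu}(z_u-z_s)$, where $\tilde\Lambda$ is the convolutional sewing map: for $\mu>1$ and $\tilde h$ of finite norm $\inf\sum_i\sup_{s<u<t}\mathcal N[\tilde h^i_{tus};\mathcal L_\gamma]|t-u|^{-\rho_i}|u-s|^{-(\mu-\rho_i)}$ (infimum over $\tilde h=\sum_i\tilde h^i$, $\rho_i\in(0,\mu)$) of the form $\tilde\delta B$, $\tilde\Lambda\tilde h$ is the unique two-parameter element with $\sup_{s<t}\mathcal N[(\tilde\Lambda\tilde h)_{ts};\mathcal L_\gamma]/|t-s|^\mu<\infty$ and $\tilde\delta\tilde\Lambda\tilde h=\tilde h$. *)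

theory Defs
  imports "HOL-Analysis.Analysis"
begin

definition in_Lg :: "(real \<Rightarrow> real) \<Rightarrow> real \<Rightarrow> (real \<Rightarrow> 'v::euclidean_space) \<Rightarrow> bool" where
  "in_Lg phi gam g \<longleftrightarrow>
     (\<lambda>\<xi>. indicator {0<..} \<xi> *\<^sub>R g \<xi>) \<in> borel_measurable lborel \<and>
     set_integrable lborel {0<..} (\<lambda>\<xi>. \<bar>phi \<xi>\<bar> * (1 + \<xi> powr gam) * norm (g \<xi>))"

definition NLg :: "(real \<Rightarrow> real) \<Rightarrow> real \<Rightarrow> (real \<Rightarrow> 'v::euclidean_space) \<Rightarrow> real" where
  "NLg phi gam g = (LINT \<xi>:{0<..}|lborel. \<bar>phi \<xi>\<bar> * (1 + \<xi> powr gam) * norm (g \<xi>))"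

text \<open>Convolutional increments.  One-parameter paths are maps t -> xi -> value,
  two-parameter paths are maps t -> s -> xi -> value (with t >= s).\<close>

definition cdelta1 :: "(real \<Rightarrow> real \<Rightarrow> 'v::real_vector) \<Rightarrow> real \<Rightarrow> real \<Rightarrow> real \<Rightarrow> 'v" where
  "cdelta1 f t s \<xi> = f t \<xi> - exp (- \<xi> * (t - s)) *\<^sub>R f s \<xi>"

definition cdelta2 :: "(real \<Rightarrow> real \<Rightarrow> real \<Rightarrow> 'v::real_vector) \<Rightarrow> real \<Rightarrow> real \<Rightarrow> real \<Rightarrow> real \<Rightarrow> 'v" where
  "cdelta2 B t u s \<xi> = B t s \<xi> - B t u \<xi> - exp (- \<xi> * (t - u)) *\<^sub>R B u s \<xi>"

definition C1_space :: "(real \<Rightarrow> real) \<Rightarrow> real \<Rightarrow> real \<Rightarrow> (real \<Rightarrow> real \<Rightarrow> 'v::euclidean_space) \<Rightarrow> bool" where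
  "C1_space phi gam T y \<longleftrightarrow>
     (\<forall>s\<in>{0..T}. in_Lg phi gam (y s)) \<and>
     (\<forall>s\<in>{0..T}. ((\<lambda>t. NLg phi gam (\<lambda>\<xi>. y t \<xi> - y s \<xi>)) \<longlongrightarrow> 0) (at s within {0..T})) \<and>
     (\<exists>C. \<forall>s\<in>{0..T}. NLg phi gam (y s) \<le> C) \<and>
     (\<exists>C. \<forall>s t. 0 \<le> s \<and> s < t \<and> t \<le> T \<longrightarrow>
          NLg phi gam (cdelta1 y t s) \<le> C * (t - s) powr gam)"

definition C2_space :: "(real \<Rightarrow> real) \<Rightarrow> real \<Rightarrow> real \<Rightarrow> (real \<Rightarrow> real \<Rightarrow> real \<Rightarrow> 'v::euclidean_space) \<Rightarrow> bool" where
  "C2_space phi gam T B \<longleftrightarrow>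
     (\<forall>s t. 0 \<le> s \<and> s \<le> t \<and> t \<le> T \<longrightarrow> in_Lg phi gam (B t s)) \<and>
     (\<forall>s t. 0 \<le> s \<and> s \<le> t \<and> t \<le> T \<longrightarrow>
        ((\<lambda>(t', s'). NLg phi gam (\<lambda>\<xi>. B t' s' \<xi> - B t s \<xi>)) \<longlongrightarrow> 0)
          (at (t, s) within {(t', s'). 0 \<le> s' \<and> s' \<le> t' \<and> t' \<le> T})) \<and>
     (\<exists>C. \<forall>s t. 0 \<le> s \<and> s < t \<and> t \<le> T \<longrightarrow> NLg phi gam (B t s) \<le> C * (t - s) powr gam)"

text \<open>Convolutional sewing map, stated relationally: B is (a representative of)
  Lambda h, i.e. B_{ts} lies in L_gamma, N[B_{ts}] <= C |t-s|^mu for some mu > 1,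
  and delta~ B = h as elements of L_gamma.  (Lambda h is unique as an element of
  L_gamma, i.e. up to N-null differences.)\<close>

definition is_sewing :: "(real \<Rightarrow> real) \<Rightarrow> real \<Rightarrow> real \<Rightarrow>
    (real \<Rightarrow> real \<Rightarrow> real \<Rightarrow> real \<Rightarrow> 'v::euclidean_space) \<Rightarrow> (real \<Rightarrow> real \<Rightarrow> real \<Rightarrow> 'v) \<Rightarrow> bool" where
  "is_sewing phi gam T h B \<longleftrightarrow>
     (\<forall>s t. 0 \<le> s \<and> s \<le> t \<and> t \<le> T \<longrightarrow> in_Lg phi gam (B t s)) \<and>
     (\<exists>\<mu>>1. \<exists>C. \<forall>s t. 0 \<le> s \<and> s < t \<and> t \<le> T \<longrightarrow> NLg phi gam (B t s) \<le> C * (t - s) powr \<mu>) \<and>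
     (\<forall>s u t. 0 \<le> s \<and> s \<le> u \<and> u \<le> t \<and> t \<le> T \<longrightarrow>
        NLg phi gam (\<lambda>\<xi>. cdelta2 B t u s \<xi> - h t u s \<xi>) = 0)"

text \<open>y solves  y_0 = 0,  delta~ y = J(d~x sigma(a0 + int phi(eta) y(eta) d eta)),
  where J_{ts} = x1_{ts} z_s + Lambda[h]_{ts}, h_{tus} = x1_{tu} (z_u - z_s);
  equalities are in L_gamma.\<close>

definition is_solution :: "(real \<Rightarrow> real) \<Rightarrow> real \<Rightarrow> real \<Rightarrow> (real \<Rightarrow> real \<Rightarrow> real \<Rightarrow> real^'d) \<Rightarrow>
    real^'m \<Rightarrow> (real^'m \<Rightarrow> real^'m^'d) \<Rightarrow> (real \<Rightarrow> real \<Rightarrow> real^'m) \<Rightarrow> bool" where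
  "is_solution phi gam T x1 a0 \<sigma> y \<longleftrightarrow>
     (let z = (\<lambda>u. \<sigma> (a0 + (LINT \<eta>:{0<..}|lborel. phi \<eta> *\<^sub>R y u \<eta>)))
      in NLg phi gam (y 0) = 0 \<and>
         (\<exists>B. is_sewing phi gam T (\<lambda>t u s \<xi>. x1 t u \<xi> v* (z u - z s)) B \<and>
              (\<forall>s t. 0 \<le> s \<and> s \<le> t \<and> t \<le> T \<longrightarrow>
                 NLg phi gam (\<lambda>\<xi>. cdelta1 y t s \<xi> - (x1 t s \<xi> v* z s + B t s \<xi>)) = 0)))"

definition holder_on :: "real \<Rightarrow> real set \<Rightarrow> (real \<Rightarrow> 'v::real_normed_vector) \<Rightarrow> bool" where
  "holder_on gam S f \<longleftrightarrow> (\<exists>C. \<forall>s\<in>S. \<forall>t\<in>S. norm (f t - f s) \<le> C * \<bar>t - s\<bar> powr gam)"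

definition C2_bounded :: "('a::euclidean_space \<Rightarrow> 'b::euclidean_space) \<Rightarrow> bool" where
  "C2_bounded f \<longleftrightarrow>
     (\<exists>Df D2f. (\<forall>a. (f has_derivative blinfun_apply (Df a)) (at a)) \<and>
               (\<forall>a. (Df has_derivative blinfun_apply (D2f a)) (at a)) \<and>
               continuous_on UNIV D2f \<and>
               (\<exists>K. \<forall>a. norm (f a) \<le> K \<and> norm (Df a) \<le> K \<and> norm (D2f a) \<le> K))"

end

theory Submission
  imports Defs
begin

text \<open>Since \<open>x1\<close> has vanishing convolutional increment, \<open>x1 t s\<close> is the increment \<open>cdelta1 X t s\<close> of
  \<open>X t = x1 t 0\<close>, up to null functions. For a Hoelder path \<open>z\<close> the integral of \<open>z\<close> against \<open>X\<close>
  is the limit of the integrals of dyadic step functions, and the remainder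
  \<open>cdelta1 Y t s - cdelta1 X t s v* z s\<close> is of order \<open>2 \<gamma> > 1\<close>, which determines \<open>Y\<close>.
  The equation only sees \<open>y\<close> through the finite-dimensional path \<open>w t = \<integral> \<phi> (y t)\<close>, whose increments
  are controlled by the norm of \<open>y\<close> because of the weight \<open>1 + \<xi>\<^sup>\<gamma>\<close>. The map sending \<open>w\<close> to the path of
  the integral of \<open>\<sigma> (a0 + w)\<close> preserves a Hoelder ball on a small time scale and is a contraction on it
  for an exponentially weighted Hoelder norm; its fixed point is the solution, and the same
  contraction estimate gives uniqueness.\<close>

subsection \<open>The weighted space and its completeness\<close>

text \<open>Functions matter only up to \<open>N\<close>-null differences. Working with a path
  \<open>X\<close> confines this to the two ends of the proof: relations between increments of
  \<open>X\<close> and of a candidate integral are then identities at every \<open>\<xi>\<close>,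
  and null functions return only in the translation to and from sewing. The condition \<gamma> > 1/2
  enters through the defect of the remainder at a midpoint, of order
  \<open>(t - s) powr (2 * gam)\<close>: halving an interval gains the factor
  \<open>2 powr (1 - 2 * gam) < 1\<close>. The fixed point has two obstacles. Comparing
  \<open>\<sigma> (a0 + w)\<close> for two paths in a Hoelder norm involves second differences of
  \<sigma>, so the contraction factor depends on the Hoelder radius \<open>R\<close>. And the
  increments of \<open>w\<close> contain the size of the integral itself, which accumulates over
  about \<open>T / e\<close> steps of length \<open>e\<close>, so \<open>R\<close> cannot be fixed
  before \<open>e\<close>: it grows as \<open>e\<close> shrinks, and only
  \<open>R * e powr gam\<close> has to stay small. For uniqueness the order is reversed, since the
  two given solutions supply \<open>R\<close> and \<open>e\<close> is chosen afterwards.\<close>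

locale Lg_space =
  fixes phi :: "real \<Rightarrow> real" and gam :: real
  assumes phi_measurable [measurable]: "phi \<in> borel_measurable borel"
begin

abbreviation in_L :: "(real \<Rightarrow> 'v::euclidean_space) \<Rightarrow> bool" where
  "in_L \<equiv> in_Lg phi gam"

abbreviation N :: "(real \<Rightarrow> 'v::euclidean_space) \<Rightarrow> real" where
  "N \<equiv> NLg phi gam"

text \<open>With the indicator inside the weight, set integrals become integrals over the whole
  line, and weighted inequalities are trivial for \<open>\<xi> \<le> 0\<close>.\<close>

definition wt :: "real \<Rightarrow> real" where
  "wt \<xi> = indicator {0<..} \<xi> * (\<bar>phi \<xi>\<bar> * (1 + \<xi> powr gam))"

lemma wt_measurable [measurable]: "wt \<in> borel_measurable borel"
  unfolding wt_def by measurable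

lemma wt_nonneg [simp]: "0 \<le> wt \<xi>"
  by (simp add: wt_def)

lemma in_L_iff:
  "in_L g \<longleftrightarrow> (\<lambda>\<xi>. indicator {0<..} \<xi> *\<^sub>R g \<xi>) \<in> borel_measurable borel
     \<and> integrable lborel (\<lambda>\<xi>. wt \<xi> * norm (g \<xi>))"
  by (simp add: in_Lg_def set_integrable_def wt_def mult.assoc)

lemma N_eq: "N g = (LINT \<xi>|lborel. wt \<xi> * norm (g \<xi>))"
  by (simp add: NLg_def set_lebesgue_integral_def wt_def mult.assoc)

lemma N_nonneg [simp]: "0 \<le> N g"
  unfolding N_eq by simp

lemma in_L_measurable:
  "in_L g \<Longrightarrow> (\<lambda>\<xi>. indicator {0<..} \<xi> *\<^sub>R g \<xi>) \<in> borel_measurable borel"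
  by (simp add: in_L_iff)

text \<open>A pointwise bound says nothing about measurability, hence the separate premise. Two
  dominating functions are what sums require; multipliers and matrices use it with
  \<open>b = 0\<close>.\<close>

lemma L_dominated:
  assumes f: "(\<lambda>\<xi>. indicator {0<..} \<xi> *\<^sub>R f \<xi>) \<in> borel_measurable borel"
    and g: "in_L g" and h: "in_L h"
    and le: "\<And>\<xi>. 0 < \<xi> \<Longrightarrow> norm (f \<xi>) \<le> a * norm (g \<xi>) + b * norm (h \<xi>)"
  shows "in_L f" and "N f \<le> a * N g + b * N h"
proof -
  have bd: "integrable lborel (\<lambda>\<xi>. a * (wt \<xi> * norm (g \<xi>)) + b * (wt \<xi> * norm (h \<xi>)))"
    using g h by (auto simp: in_L_iff)
  have le': "wt \<xi> * norm (f \<xi>) \<le> a * (wt \<xi> * norm (g \<xi>)) + b * (wt \<xi> * norm (h \<xi>))" for \<xi>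
  proof (cases "0 < \<xi>")
    case True
    have "wt \<xi> * norm (f \<xi>) \<le> wt \<xi> * (a * norm (g \<xi>) + b * norm (h \<xi>))"
      by (rule mult_left_mono[OF le[OF True]]) simp
    then show ?thesis by (simp add: algebra_simps)
  qed (simp add: wt_def)
  have eq: "wt \<xi> * norm (f \<xi>) = wt \<xi> * norm (indicator {0<..} \<xi> *\<^sub>R f \<xi>)" for \<xi>
    by (simp add: wt_def indicator_def)
  have meas: "(\<lambda>\<xi>. wt \<xi> * norm (f \<xi>)) \<in> borel_measurable lborel"
    unfolding eq using f by measurable
  have int: "integrable lborel (\<lambda>\<xi>. wt \<xi> * norm (f \<xi>))"
  proof (rule Bochner_Integration.integrable_bound[OF bd meas])
    have "norm (wt \<xi> * norm (f \<xi>)) \<le> norm (a * (wt \<xi> * norm (g \<xi>)) + b * (wt \<xi> * norm (h \<xi>)))" for \<xi>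
      using le'[of \<xi>] by (simp add: abs_mult)
    then show "AE \<xi> in lborel. norm (wt \<xi> * norm (f \<xi>))
        \<le> norm (a * (wt \<xi> * norm (g \<xi>)) + b * (wt \<xi> * norm (h \<xi>)))" by simp
  qed
  show "in_L f" using f int by (simp add: in_L_iff)
  have "N f \<le> (LINT \<xi>|lborel. a * (wt \<xi> * norm (g \<xi>)) + b * (wt \<xi> * norm (h \<xi>)))"
    unfolding N_eq by (rule integral_mono[OF int bd le'])
  also have "\<dots> = a * N g + b * N h"
    using g h by (simp add: N_eq in_L_iff)
  finally show "N f \<le> a * N g + b * N h" .
qed

lemma L_zero [simp]: "in_L (\<lambda>\<xi>. 0)" "N (\<lambda>\<xi>. 0) = 0"
  by (simp_all add: in_L_iff N_eq)

lemma L_multiplier: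
  assumes g: "in_L g" and c: "c \<in> borel_measurable borel"
    and le: "\<And>\<xi>. 0 < \<xi> \<Longrightarrow> \<bar>c \<xi>\<bar> \<le> C"
  shows "in_L (\<lambda>\<xi>. c \<xi> *\<^sub>R g \<xi>)" and "N (\<lambda>\<xi>. c \<xi> *\<^sub>R g \<xi>) \<le> C * N g"
proof -
  have "(\<lambda>\<xi>. c \<xi> *\<^sub>R (indicator {0<..} \<xi> *\<^sub>R g \<xi>)) \<in> borel_measurable borel"
    using c in_L_measurable[OF g] by measurable
  then have m: "(\<lambda>\<xi>. indicator {0<..} \<xi> *\<^sub>R (c \<xi> *\<^sub>R g \<xi>)) \<in> borel_measurable borel"
    by (simp add: mult.commute)
  have "norm (c \<xi> *\<^sub>R g \<xi>) \<le> C * norm (g \<xi>) + 0 * norm (g \<xi>)" if "0 < \<xi>" for \<xi>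
    using mult_right_mono[OF le[OF that], of "norm (g \<xi>)"] by simp
  from L_dominated[OF m g g this]
  show "in_L (\<lambda>\<xi>. c \<xi> *\<^sub>R g \<xi>)" "N (\<lambda>\<xi>. c \<xi> *\<^sub>R g \<xi>) \<le> C * N g" by auto
qed

lemma L_exp:
  assumes "in_L g" "0 \<le> d"
  shows "in_L (\<lambda>\<xi>. exp (- \<xi> * d) *\<^sub>R g \<xi>)" and "N (\<lambda>\<xi>. exp (- \<xi> * d) *\<^sub>R g \<xi>) \<le> N g"
proof -
  have *: "(\<lambda>\<xi>. exp (- \<xi> * d)) \<in> borel_measurable borel"
    "\<And>\<xi>. 0 < \<xi> \<Longrightarrow> \<bar>exp (- \<xi> * d)\<bar> \<le> 1"
    using assms(2) by simp_all
  show "in_L (\<lambda>\<xi>. exp (- \<xi> * d) *\<^sub>R g \<xi>)" by (rule L_multiplier(1)[OF assms(1) *])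
  show "N (\<lambda>\<xi>. exp (- \<xi> * d) *\<^sub>R g \<xi>) \<le> N g"
    using L_multiplier(2)[OF assms(1) *] by simp
qed

lemma L_add:
  assumes g: "in_L g" and h: "in_L h"
  shows "in_L (\<lambda>\<xi>. g \<xi> + h \<xi>)" and "N (\<lambda>\<xi>. g \<xi> + h \<xi>) \<le> N g + N h"
proof -
  have "(\<lambda>\<xi>. indicator {0<..} \<xi> *\<^sub>R (g \<xi> + h \<xi>)) \<in> borel_measurable borel"
    using borel_measurable_add[OF in_L_measurable[OF g] in_L_measurable[OF h]]
    by (simp add: scaleR_add_right)
  from L_dominated[OF this g h, of 1 1]
  show "in_L (\<lambda>\<xi>. g \<xi> + h \<xi>)" "N (\<lambda>\<xi>. g \<xi> + h \<xi>) \<le> N g + N h"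
    by (auto simp: norm_triangle_ineq)
qed

lemma L_uminus:
  assumes g: "in_L g"
  shows "in_L (\<lambda>\<xi>. - g \<xi>)" and "N (\<lambda>\<xi>. - g \<xi>) = N g"
proof -
  have "in_L (\<lambda>\<xi>. (- 1) *\<^sub>R g \<xi>)" by (rule L_multiplier(1)[OF g, where C = 1]) simp_all
  then show "in_L (\<lambda>\<xi>. - g \<xi>)" by simp
  show "N (\<lambda>\<xi>. - g \<xi>) = N g" by (simp add: N_eq)
qed

lemma L_diff:
  assumes g: "in_L g" and h: "in_L h"
  shows "in_L (\<lambda>\<xi>. g \<xi> - h \<xi>)" and "N (\<lambda>\<xi>. g \<xi> - h \<xi>) \<le> N g + N h"
  using L_add[OF g L_uminus(1)[OF h]] L_uminus(2)[OF h] by simp_all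

lemma L_sum:
  assumes "\<And>i. i \<in> I \<Longrightarrow> in_L (g i)"
  shows "in_L (\<lambda>\<xi>. \<Sum>i\<in>I. g i \<xi>)"
  using assms
proof (induction I rule: infinite_finite_induct)
  case (insert i I)
  then show ?case using L_add(1)[of "g i" "\<lambda>\<xi>. \<Sum>i\<in>I. g i \<xi>"] by simp
qed simp_all

end

section \<open>Row vectors acting on matrices\<close>

lemma norm_vector_matrix_mult_le:
  fixes x :: "real^'d" and A :: "real^'m^'d"
  shows "norm (x v* A) \<le> norm x * norm A"
proof -
  have "x v* A = (\<Sum>i\<in>UNIV. (x $ i) *\<^sub>R (A $ i))"
    by (simp add: vec_eq_iff vector_matrix_mult_def mult.commute)
  then have "norm (x v* A) \<le> (\<Sum>i\<in>UNIV. \<bar>x $ i\<bar> * \<bar>norm (A $ i)\<bar>)"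
    by (simp add: sum_norm_le)
  also have "\<dots> \<le> L2_set (($) x) UNIV * L2_set (\<lambda>i. norm (A $ i)) UNIV"
    by (rule L2_set_mult_ineq)
  also have "\<dots> = norm x * norm A"
    by (simp add: norm_vec_def L2_set_def)
  finally show ?thesis .
qed

lemma bounded_linear_vector_matrix_mult_left: "bounded_linear (\<lambda>x::real^'d. x v* (A::real^'m^'d))"
  by (rule bounded_linear_intro[where K = "norm A"])
     (auto simp: vector_matrix_left_distrib scaleR_vector_matrix_assoc norm_vector_matrix_mult_le)

lemma vector_matrix_mult_diff_rdistrib: "(x - y :: real^'d) v* (A :: real^'m^'d) = x v* A - y v* A"
  by (rule linear_diff[OF bounded_linear.linear[OF bounded_linear_vector_matrix_mult_left]])

lemma vector_matrix_mult_diff_distrib: "(x :: real^'d) v* (A - B :: real^'m^'d) = x v* A - x v* B"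
  by (simp add: vec_eq_iff vector_matrix_mult_def algebra_simps sum_subtractf)

context Lg_space
begin

lemma L_vector_matrix:
  fixes g :: "real \<Rightarrow> real^'d" and A :: "real^'m^'d"
  assumes g: "in_L g"
  shows "in_L (\<lambda>\<xi>. g \<xi> v* A)" and "N (\<lambda>\<xi>. g \<xi> v* A) \<le> norm A * N g"
proof -
  have "(\<lambda>\<xi>. (indicator {0<..} \<xi> *\<^sub>R g \<xi>) v* A) \<in> borel_measurable borel"
    using in_L_measurable[OF g]
    by (rule measurable_compose)
       (intro borel_measurable_continuous_onI linear_continuous_on bounded_linear_vector_matrix_mult_left)
  then have m: "(\<lambda>\<xi>. indicator {0<..} \<xi> *\<^sub>R (g \<xi> v* A)) \<in> borel_measurable borel"
    by (simp add: scaleR_vector_matrix_assoc)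
  have "norm (g \<xi> v* A) \<le> norm A * norm (g \<xi>) + 0 * norm (g \<xi>)" for \<xi>
    using norm_vector_matrix_mult_le[of "g \<xi>" A] by (simp add: mult.commute)
  from L_dominated[OF m g g this]
  show "in_L (\<lambda>\<xi>. g \<xi> v* A)" "N (\<lambda>\<xi>. g \<xi> v* A) \<le> norm A * N g" by auto
qed

lemma L_cdelta1:
  assumes "in_L (y t)" "in_L (y s)" "s \<le> t"
  shows "in_L (cdelta1 y t s)"
  unfolding cdelta1_def using assms by (intro L_diff(1) L_exp(1)) auto

text \<open>The exponential factor contracts \<open>N\<close>, so the size of a path can be followed
  from one time to a later one through convolutional increments alone.\<close>

lemma N_le_cdelta1:
  assumes "in_L (y t)" "in_L (y s)" "s \<le> t"
  shows "N (y t) \<le> N (y s) + N (cdelta1 y t s)"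
proof -
  have "y t = (\<lambda>\<xi>. cdelta1 y t s \<xi> + exp (- \<xi> * (t - s)) *\<^sub>R y s \<xi>)"
    by (auto simp: cdelta1_def)
  moreover have "N (\<lambda>\<xi>. cdelta1 y t s \<xi> + exp (- \<xi> * (t - s)) *\<^sub>R y s \<xi>)
      \<le> N (cdelta1 y t s) + N (\<lambda>\<xi>. exp (- \<xi> * (t - s)) *\<^sub>R y s \<xi>)"
    using assms by (intro L_add(2) L_cdelta1 L_exp(1)) auto
  ultimately have "N (y t) \<le> N (cdelta1 y t s) + N (\<lambda>\<xi>. exp (- \<xi> * (t - s)) *\<^sub>R y s \<xi>)"
    by simp
  then show ?thesis using L_exp(2)[OF assms(2), of "t - s"] assms(3) by simp
qed

end

text \<open>Interpolation between \<open>1 - exp (- a) \<le> a\<close>, which is the better bound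
  for small \<open>a\<close>, and \<open>1 - exp (- a) \<le> 1\<close>.\<close>

lemma one_minus_exp_le_powr:
  fixes a p :: real
  assumes "0 \<le> a" "0 \<le> p" "p \<le> 1"
  shows "1 - exp (- a) \<le> a powr p"
proof (cases "a \<le> 1")
  case True
  show ?thesis
  proof (cases "a = 0")
    case False
    have "1 - exp (- a) \<le> a" using exp_ge_add_one_self[of "- a"] by simp
    also have "\<dots> = a powr 1" using assms by simp
    also have "\<dots> \<le> a powr p" using True False assms by (intro powr_mono') auto
    finally show ?thesis .
  qed simp
next
  case False
  then have "1 \<le> a powr p" using assms by (simp add: ge_one_powr_ge_zero)
  moreover have "1 - exp (- a) \<le> 1" by simp
  ultimately show ?thesis by linarith
qed

section \<open>Integration against \<open>phi\<close> and completeness\<close>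

context Lg_space
begin

definition phi_int :: "(real \<Rightarrow> 'v::euclidean_space) \<Rightarrow> 'v" where
  "phi_int g = (LINT \<eta>:{0<..}|lborel. phi \<eta> *\<^sub>R g \<eta>)"

lemma phi_integrable:
  assumes g: "in_L g"
  shows "set_integrable lborel {0<..} (\<lambda>\<eta>. phi \<eta> *\<^sub>R g \<eta>)"
  unfolding set_integrable_def
proof (rule Bochner_Integration.integrable_bound)
  show "integrable lborel (\<lambda>\<xi>. wt \<xi> * norm (g \<xi>))" using g by (simp add: in_L_iff)
  have "(\<lambda>\<xi>. phi \<xi> *\<^sub>R (indicator {0<..} \<xi> *\<^sub>R g \<xi>)) \<in> borel_measurable borel"
    using in_L_measurable[OF g] by measurable
  then show "(\<lambda>\<xi>. indicator {0<..} \<xi> *\<^sub>R phi \<xi> *\<^sub>R g \<xi>) \<in> borel_measurable lborel"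
    by (simp add: mult.commute)
  have "norm (indicator {0<..} \<xi> *\<^sub>R phi \<xi> *\<^sub>R g \<xi>) \<le> norm (wt \<xi> * norm (g \<xi>))" for \<xi>
  proof (cases "0 < \<xi>")
    case True
    have "\<bar>phi \<xi>\<bar> * 1 \<le> \<bar>phi \<xi>\<bar> * (1 + \<xi> powr gam)" by (rule mult_left_mono) auto
    from mult_right_mono[OF this, of "norm (g \<xi>)"] True show ?thesis
      by (simp add: wt_def abs_mult)
  qed simp
  then show "AE \<xi> in lborel. norm (indicator {0<..} \<xi> *\<^sub>R phi \<xi> *\<^sub>R g \<xi>) \<le> norm (wt \<xi> * norm (g \<xi>))"
    by simp
qed

lemma phi_int_diff:
  assumes "in_L g" "in_L h"
  shows "phi_int (\<lambda>\<xi>. g \<xi> - h \<xi>) = phi_int g - phi_int h"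
  unfolding phi_int_def scaleR_diff_right
  using set_integral_diff(2)[OF phi_integrable[OF assms(1)] phi_integrable[OF assms(2)]] .

text \<open>The weight pays for replacing the convolutional by the ordinary increment, since
  \<open>1 - exp (- \<xi> d) \<le> \<xi>\<^sup>\<gamma> d\<^sup>\<gamma>\<close>.\<close>

lemma norm_phi_int_increment_le:
  assumes y: "in_L (y t)" "in_L (y s)" and "s \<le> t" and gam: "0 \<le> gam" "gam \<le> 1"
  shows "norm (phi_int (y t) - phi_int (y s)) \<le> N (cdelta1 y t s) + (t - s) powr gam * N (y s)"
proof -
  let ?D = "cdelta1 y t s"
  have D: "in_L ?D" using assms by (intro L_cdelta1)
  have bd: "integrable lborel (\<lambda>\<xi>. wt \<xi> * norm (?D \<xi>) + (t - s) powr gam * (wt \<xi> * norm (y s \<xi>)))"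
    using D y by (auto simp: in_L_iff)
  have le: "norm (indicator {0<..} \<xi> *\<^sub>R (phi \<xi> *\<^sub>R (y t \<xi> - y s \<xi>)))
     \<le> wt \<xi> * norm (?D \<xi>) + (t - s) powr gam * (wt \<xi> * norm (y s \<xi>))" for \<xi>
  proof (cases "0 < \<xi>")
    case True
    have "1 - exp (- (\<xi> * (t - s))) \<le> (\<xi> * (t - s)) powr gam"
      using True assms by (intro one_minus_exp_le_powr) auto
    also have "\<dots> = \<xi> powr gam * (t - s) powr gam" using True assms by (simp add: powr_mult)
    finally have e: "1 - exp (- \<xi> * (t - s)) \<le> \<xi> powr gam * (t - s) powr gam" by simp
    have "y t \<xi> - y s \<xi> = ?D \<xi> - (1 - exp (- \<xi> * (t - s))) *\<^sub>R y s \<xi>"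
      by (simp add: cdelta1_def algebra_simps)
    then have "norm (y t \<xi> - y s \<xi>) \<le> norm (?D \<xi>) + \<bar>1 - exp (- \<xi> * (t - s))\<bar> * norm (y s \<xi>)"
      by (metis norm_scaleR norm_triangle_ineq4)
    also have "\<bar>1 - exp (- \<xi> * (t - s))\<bar> = 1 - exp (- \<xi> * (t - s))"
      using True assms by simp
    also have "norm (?D \<xi>) + (1 - exp (- \<xi> * (t - s))) * norm (y s \<xi>)
       \<le> (1 + \<xi> powr gam) * norm (?D \<xi>) + ((1 + \<xi> powr gam) * (t - s) powr gam) * norm (y s \<xi>)"
    proof (intro add_mono mult_right_mono)
      show "norm (?D \<xi>) \<le> (1 + \<xi> powr gam) * norm (?D \<xi>)" by (simp add: algebra_simps)
      have "0 \<le> (t - s) powr gam" by simp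
      then show "1 - exp (- \<xi> * (t - s)) \<le> (1 + \<xi> powr gam) * (t - s) powr gam"
        using e unfolding distrib_right by linarith
    qed simp
    finally have "\<bar>phi \<xi>\<bar> * norm (y t \<xi> - y s \<xi>) \<le> \<bar>phi \<xi>\<bar> * ((1 + \<xi> powr gam) * norm (?D \<xi>)
       + ((1 + \<xi> powr gam) * (t - s) powr gam) * norm (y s \<xi>))"
      by (rule mult_left_mono) simp
    then show ?thesis using True by (simp add: wt_def distrib_left distrib_right mult_ac)
  qed (simp add: wt_def)
  have "norm (phi_int (\<lambda>\<xi>. y t \<xi> - y s \<xi>)) \<le> (LINT \<xi>|lborel. wt \<xi> * norm (?D \<xi>) + (t - s) powr gam * (wt \<xi> * norm (y s \<xi>)))"
    unfolding phi_int_def set_lebesgue_integral_def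
    by (rule order_trans[OF integral_norm_bound integral_mono[OF _ bd le]])
       (rule integrable_norm[OF phi_integrable[OF L_diff(1)[OF y], unfolded set_integrable_def]])
  also have "\<dots> = N ?D + (t - s) powr gam * N (y s)"
  proof -
    have "integrable lborel (\<lambda>\<xi>. wt \<xi> * norm (?D \<xi>))" "integrable lborel (\<lambda>\<xi>. wt \<xi> * norm (y s \<xi>))"
      using D y unfolding in_L_iff by blast+
    then show ?thesis unfolding N_eq by simp
  qed
  finally show ?thesis unfolding phi_int_diff[OF y] .
qed

lemma norm_phi_int_le:
  assumes g: "in_L g" and gam: "0 < gam" "gam \<le> 1"
  shows "norm (phi_int g) \<le> N g"
proof -
  \<comment> \<open>A path that jumps from zero to \<open>g\<close>: its convolutional increment
    from time 0 to 1 is \<open>g\<close>, and the term with the starting value vanishes, so the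
    increment estimate becomes a bound for a single function.\<close>
  define y :: "real \<Rightarrow> real \<Rightarrow> 'a" where "y t = (if t = 1 then g else (\<lambda>\<xi>. 0))" for t
  have y: "y 1 = g" "y 0 = (\<lambda>\<xi>. 0)" by (simp_all add: y_def)
  have "cdelta1 y 1 0 = g" by (auto simp: cdelta1_def y)
  moreover have "phi_int (y 0) = 0" by (simp add: y phi_int_def set_lebesgue_integral_def)
  ultimately show ?thesis
    using norm_phi_int_increment_le[of y 1 0] g gam by (simp add: y)
qed

text \<open>The Riesz-Fischer argument, transported by multiplication with \<open>wt\<close> to an
  absolutely convergent series of integrable functions. Summable steps are the natural hypothesis,
  because dyadic approximations differ by a geometric sequence.\<close>

lemma L_complete:
  fixes g :: "nat \<Rightarrow> real \<Rightarrow> 'v::euclidean_space"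
  assumes g: "\<And>n. in_L (g n)"
    and le: "\<And>n. N (\<lambda>\<xi>. g (Suc n) \<xi> - g n \<xi>) \<le> c n" and c: "summable c"
  shows "\<exists>f. in_L f \<and> (\<lambda>n. N (\<lambda>\<xi>. f \<xi> - g n \<xi>)) \<longlonglongrightarrow> 0"
proof -
  define F where "F n \<xi> = wt \<xi> *\<^sub>R (g (Suc n) \<xi> - g n \<xi>)" for n \<xi>
  have d: "in_L (\<lambda>\<xi>. g (Suc n) \<xi> - g n \<xi>)" for n by (rule L_diff(1)[OF g g])
  have Feq: "F n \<xi> = wt \<xi> *\<^sub>R (indicator {0<..} \<xi> *\<^sub>R (g (Suc n) \<xi> - g n \<xi>))" for n \<xi>
    by (simp add: F_def wt_def indicator_def)
  have Fm [measurable]: "F n \<in> borel_measurable borel" for n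
    unfolding Feq[abs_def] using in_L_measurable[OF d] by measurable
  have nF: "norm (F n \<xi>) = wt \<xi> * norm (g (Suc n) \<xi> - g n \<xi>)" for n \<xi> by (simp add: F_def)
  have Fn: "integrable lborel (\<lambda>\<xi>. norm (F n \<xi>))" for n
    using d[of n] by (simp add: in_L_iff nF)
  have IF: "(LINT \<xi>|lborel. norm (F n \<xi>)) \<le> c n" for n
    using le[of n] by (simp add: N_eq nF)
  have sI: "summable (\<lambda>n. LINT \<xi>|lborel. norm (F n \<xi>))"
    by (rule summable_comparison_test'[OF c, of 0]) (simp add: IF)
  \<comment> \<open>The integral of the series of norms equals the finite sum of the integrals, so
    the series of norms is finite almost everywhere.\<close>
  have AE: "AE \<xi> in lborel. summable (\<lambda>n. norm (F n \<xi>))"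
  proof -
    have "(\<integral>\<^sup>+\<xi>. (\<Sum>n. ennreal (norm (F n \<xi>))) \<partial>lborel) = (\<Sum>n. \<integral>\<^sup>+\<xi>. ennreal (norm (F n \<xi>)) \<partial>lborel)"
      by (rule nn_integral_suminf) simp
    also have "\<dots> = (\<Sum>n. ennreal (LINT \<xi>|lborel. norm (F n \<xi>)))"
      using nn_integral_eq_integral[OF Fn] by simp
    also have "\<dots> = ennreal (\<Sum>n. LINT \<xi>|lborel. norm (F n \<xi>))"
      by (rule suminf_ennreal2[OF _ sI]) simp
    finally have "(\<integral>\<^sup>+\<xi>. (\<Sum>n. ennreal (norm (F n \<xi>))) \<partial>lborel) \<noteq> \<infinity>" by simp
    then have "AE \<xi> in lborel. (\<Sum>n. ennreal (norm (F n \<xi>))) \<noteq> \<infinity>"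
      by (intro nn_integral_PInf_AE) auto
    then show ?thesis
      by eventually_elim (auto intro: summable_suminf_not_top)
  qed
  have IG: "integrable lborel (\<lambda>\<xi>. \<Sum>n. norm (F n \<xi>))"
    using integrable_suminf[of lborel "\<lambda>n \<xi>. norm (F n \<xi>)"] Fn AE sI by simp
  define S where "S \<xi> = (\<Sum>n. F n \<xi>)" for \<xi>
  have Sm [measurable]: "S \<in> borel_measurable borel" unfolding S_def[abs_def] by measurable
  \<comment> \<open>Division by the weight. Where \<open>wt \<xi> = 0\<close>, the convention
    \<open>inverse 0 = 0\<close> gives \<open>f \<xi> = g 0 \<xi>\<close>, and both sides of the
    identity \<open>key\<close> below are zero there, so it holds at every
    \<open>\<xi>\<close>.\<close>
  define f where "f \<xi> = g 0 \<xi> + inverse (wt \<xi>) *\<^sub>R S \<xi>" for \<xi>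
  have F0: "S \<xi> = 0" if "wt \<xi> = 0" for \<xi> using that by (simp add: S_def F_def)
  have tel: "wt \<xi> *\<^sub>R (g n \<xi> - g 0 \<xi>) = (\<Sum>k<n. F k \<xi>)" for n \<xi>
    using sum_lessThan_telescope[of "\<lambda>n. g n \<xi>" n]
    by (simp add: F_def scaleR_sum_right[symmetric])
  have key: "wt \<xi> *\<^sub>R (f \<xi> - g n \<xi>) = S \<xi> - (\<Sum>k<n. F k \<xi>)" for n \<xi>
  proof -
    have "wt \<xi> *\<^sub>R (f \<xi> - g 0 \<xi>) = S \<xi>" by (cases "wt \<xi> = 0") (auto simp: f_def F0)
    then show ?thesis unfolding tel[symmetric] by (simp add: algebra_simps)
  qed
  have key': "wt \<xi> * norm (f \<xi> - g n \<xi>) = norm (S \<xi> - (\<Sum>k<n. F k \<xi>))" for n \<xi>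
    unfolding key[symmetric] by simp
  have lim: "(\<lambda>n. LINT \<xi>|lborel. norm (S \<xi> - (\<Sum>k<n. F k \<xi>))) \<longlonglongrightarrow> (LINT (\<xi>::real)|lborel. (0::real))"
   and int: "\<And>n. integrable lborel (\<lambda>\<xi>. norm (S \<xi> - (\<Sum>k<n. F k \<xi>)))"
  proof -
    have *: "norm (S \<xi> - (\<Sum>k<n. F k \<xi>)) \<le> (\<Sum>n. norm (F n \<xi>))" if "summable (\<lambda>n. norm (F n \<xi>))" for \<xi> n
    proof -
      have sF: "summable (\<lambda>n. F n \<xi>)" using that by (rule summable_norm_cancel)
      have "S \<xi> - (\<Sum>k<n. F k \<xi>) = (\<Sum>k. F (k + n) \<xi>)"
        unfolding S_def using suminf_split_initial_segment[OF sF, of n] by simp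
      also have "norm \<dots> \<le> (\<Sum>k. norm (F (k + n) \<xi>))"
        using that by (intro summable_norm) (simp add: summable_iff_shift[of "\<lambda>n. norm (F n \<xi>)"])
      also have "\<dots> = (\<Sum>k. norm (F k \<xi>)) - (\<Sum>k<n. norm (F k \<xi>))"
        using suminf_split_initial_segment[OF that, of n] by simp
      also have "\<dots> \<le> (\<Sum>k. norm (F k \<xi>))" by (simp add: sum_nonneg)
      finally show ?thesis .
    qed
    have conv: "AE \<xi> in lborel. (\<lambda>n. norm (S \<xi> - (\<Sum>k<n. F k \<xi>))) \<longlonglongrightarrow> 0"
      using AE
    proof eventually_elim
      case (elim \<xi>)
      then have "(\<lambda>n. \<Sum>k<n. F k \<xi>) \<longlonglongrightarrow> S \<xi>"
        unfolding S_def by (rule summable_LIMSEQ[OF summable_norm_cancel])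
      then have "(\<lambda>n. (\<Sum>k<n. F k \<xi>) - S \<xi>) \<longlonglongrightarrow> 0" by (simp add: LIM_zero_iff)
      then show ?case
        by (simp add: tendsto_norm_zero_iff norm_minus_commute[of "S \<xi>"])
    qed
    have bd: "AE \<xi> in lborel. norm (norm (S \<xi> - (\<Sum>k<n. F k \<xi>))) \<le> (\<Sum>n. norm (F n \<xi>))" for n
      using AE by eventually_elim (use * in auto)
    show "(\<lambda>n. LINT \<xi>|lborel. norm (S \<xi> - (\<Sum>k<n. F k \<xi>))) \<longlonglongrightarrow> (LINT (\<xi>::real)|lborel. (0::real))"
      by (rule integral_dominated_convergence[OF _ _ IG conv bd]) auto
    show "integrable lborel (\<lambda>\<xi>. norm (S \<xi> - (\<Sum>k<n. F k \<xi>)))" for n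
      by (rule integrable_dominated_convergence2[OF _ _ IG conv bd]) auto
  qed
  have meas: "(\<lambda>\<xi>. indicator {0<..} \<xi> *\<^sub>R (f \<xi> - g 0 \<xi>)) \<in> borel_measurable borel"
  proof -
    have "(\<lambda>\<xi>. indicator {0<..} \<xi> *\<^sub>R (inverse (wt \<xi>) *\<^sub>R S \<xi>)) \<in> borel_measurable borel"
      by (intro borel_measurable_scaleR borel_measurable_inverse) auto
    then show ?thesis by (simp add: f_def)
  qed
  have "in_L (\<lambda>\<xi>. f \<xi> - g 0 \<xi>)"
    unfolding in_L_iff key' using meas int[of 0] by blast
  from L_add(1)[OF this g[of 0]] have "in_L f" by simp
  moreover have "(\<lambda>n. N (\<lambda>\<xi>. f \<xi> - g n \<xi>)) \<longlonglongrightarrow> 0"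
    unfolding N_eq key' using lim by simp
  ultimately show ?thesis by blast
qed

subsection \<open>Convolutional Young integrals\<close>

lemma N_le_cdelta2:
  assumes "in_L (B t s)" "in_L (B t u)" "in_L (B u s)" "u \<le> t"
  shows "N (B t s) \<le> N (cdelta2 B t u s) + N (B t u) + N (B u s)"
proof -
  have e: "in_L (\<lambda>\<xi>. exp (- \<xi> * (t - u)) *\<^sub>R B u s \<xi>)"
    "N (\<lambda>\<xi>. exp (- \<xi> * (t - u)) *\<^sub>R B u s \<xi>) \<le> N (B u s)"
    using assms by (simp_all only: L_exp diff_ge_0_iff_ge)
  have d: "in_L (cdelta2 B t u s)"
    unfolding cdelta2_def[abs_def] by (intro L_diff(1) e assms)
  have 1: "in_L (\<lambda>\<xi>. cdelta2 B t u s \<xi> + B t u \<xi>)"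
    and 2: "N (\<lambda>\<xi>. cdelta2 B t u s \<xi> + B t u \<xi>) \<le> N (cdelta2 B t u s) + N (B t u)"
    by (intro L_add d assms)+
  have 3: "N (\<lambda>\<xi>. (cdelta2 B t u s \<xi> + B t u \<xi>) + exp (- \<xi> * (t - u)) *\<^sub>R B u s \<xi>)
     \<le> N (\<lambda>\<xi>. cdelta2 B t u s \<xi> + B t u \<xi>) + N (\<lambda>\<xi>. exp (- \<xi> * (t - u)) *\<^sub>R B u s \<xi>)"
    by (rule L_add(2)[OF 1 e(1)])
  have "(\<lambda>\<xi>. (cdelta2 B t u s \<xi> + B t u \<xi>) + exp (- \<xi> * (t - u)) *\<^sub>R B u s \<xi>) = B t s"
    by (auto simp: cdelta2_def)
  with 2 3 e(2) show ?thesis by simp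
qed

text \<open>Splitting at midpoints multiplies the a priori bound \<open>C (t - s)\<^sup>\<mu>\<close> by
  \<open>2 powr (1 - \<mu>) < 1\<close> and reproduces the claimed bound, so that \<open>C\<close> disappears in the limit.\<close>

lemma sewing_bound:
  fixes B :: "real \<Rightarrow> real \<Rightarrow> real \<Rightarrow> 'v::euclidean_space"
  assumes L: "\<And>s t. a \<le> s \<Longrightarrow> s < t \<Longrightarrow> t \<le> b \<Longrightarrow> in_L (B t s)"
    and C: "\<And>s t. a \<le> s \<Longrightarrow> s < t \<Longrightarrow> t \<le> b \<Longrightarrow> N (B t s) \<le> C * (t - s) powr \<mu>"
    and A: "\<And>s t. a \<le> s \<Longrightarrow> s < t \<Longrightarrow> t \<le> b \<Longrightarrow>
       N (cdelta2 B t ((s + t) / 2) s) \<le> A * (t - s) powr \<rho>"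
    and "1 < \<mu>" "1 < \<rho>" "0 \<le> A" "a \<le> s" "s < t" "t \<le> b"
  shows "N (B t s) \<le> A / (1 - 2 powr (1 - \<rho>)) * (t - s) powr \<rho>"
proof -
  define r where "r = (2::real) powr (1 - \<rho>)"
  define q where "q = (2::real) powr (1 - \<mu>)"
  have r: "0 < r" "r < 1" and q: "0 < q" "q < 1"
    using assms by (auto simp: r_def q_def powr_less_one)
  \<comment> \<open>The fixed point of \<open>K \<mapsto> A + K * r\<close>: the defect
    \<open>A\<close> plus the two halves, which together contribute \<open>K * r\<close>, give back
    \<open>K\<close>.\<close>
  define K where "K = A / (1 - r)"
  have K: "A + K * r = K" "0 \<le> K" using r \<open>0 \<le> A\<close> by (auto simp: K_def field_simps)
  have half: "2 * (d / 2) powr p = 2 powr (1 - p) * d powr p" if "0 < d" for d p :: real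
    using that by (simp add: powr_divide powr_diff)
  have bd: "N (B t s) \<le> K * (t - s) powr \<rho> + C * q ^ n * (t - s) powr \<mu>"
    if "a \<le> s" "s < t" "t \<le> b" for s t n
    using that
  proof (induction n arbitrary: s t)
    case 0
    then show ?case using C[of s t] K by (simp add: add_increasing)
  next
    case (Suc n)
    define d where "d = t - s"
    define m where "m = (s + t) / 2"
    have m: "s < m" "m < t" "t - m = d / 2" "m - s = d / 2" and d: "0 < d"
      using Suc.prems by (auto simp: m_def d_def field_simps)
    have "N (B t s) \<le> N (cdelta2 B t m s) + N (B t m) + N (B m s)"
      using Suc.prems m by (intro N_le_cdelta2 L) auto
    also have "\<dots> \<le> A * d powr \<rho> + (K * (t - m) powr \<rho> + C * q ^ n * (t - m) powr \<mu>)
        + (K * (m - s) powr \<rho> + C * q ^ n * (m - s) powr \<mu>)"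
      using A[of s t] Suc.prems m unfolding m_def[symmetric] d_def[symmetric]
      by (intro add_mono Suc.IH) auto
    also have "\<dots> = A * d powr \<rho> + K * (2 * (d / 2) powr \<rho>) + C * q ^ n * (2 * (d / 2) powr \<mu>)"
      unfolding m by simp
    also have "\<dots> = (A + K * r) * d powr \<rho> + C * q ^ Suc n * d powr \<mu>"
      unfolding half[OF d] r_def q_def by (simp add: algebra_simps)
    finally show ?case unfolding K d_def .
  qed
  have "(\<lambda>n. K * (t - s) powr \<rho> + C * q ^ n * (t - s) powr \<mu>)
      \<longlonglongrightarrow> K * (t - s) powr \<rho> + C * 0 * (t - s) powr \<mu>"
    using q by (intro tendsto_intros LIMSEQ_power_zero) auto
  then have "N (B t s) \<le> K * (t - s) powr \<rho> + C * 0 * (t - s) powr \<mu>"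
    by (rule LIMSEQ_le_const) (use bd assms in auto)
  then show ?thesis by (simp add: K_def r_def)
qed

end

lemma exp_neg_split:
  fixes \<xi> t u s :: real
  shows "exp (- \<xi> * (t - s)) = exp (- \<xi> * (t - u)) * exp (- \<xi> * (u - s))"
  by (simp add: exp_add[symmetric] algebra_simps)

text \<open>The semigroup law of the exponential, saying that \<open>cdelta2\<close> vanishes on
  \<open>cdelta1 Y\<close>. All defects of remainders are computed from it.\<close>

lemma cdelta1_split:
  "cdelta1 Y t s \<xi> = cdelta1 Y t u \<xi> + exp (- \<xi> * (t - u)) *\<^sub>R cdelta1 Y u s \<xi>"
  by (simp only: cdelta1_def exp_neg_split[of \<xi> t s u] scaleR_diff_right scaleR_scaleR) simp

locale Young_driver = Lg_space +
  fixes T Cx :: real and X :: "real \<Rightarrow> real \<Rightarrow> real^'d"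
  assumes gam: "1 / 2 < gam" "gam < 1" and T: "0 < T" and Cx: "0 \<le> Cx"
    and X_in: "\<And>t. 0 \<le> t \<Longrightarrow> t \<le> T \<Longrightarrow> in_L (X t)"
    and X_le: "\<And>s t. 0 \<le> s \<Longrightarrow> s \<le> t \<Longrightarrow> t \<le> T \<Longrightarrow> N (cdelta1 X t s) \<le> Cx * (t - s) powr gam"
begin

definition Young_rem :: "(real \<Rightarrow> real \<Rightarrow> real^'m) \<Rightarrow> (real \<Rightarrow> real^'m^'d) \<Rightarrow> real \<Rightarrow> real \<Rightarrow> real \<Rightarrow> real^'m" where
  "Young_rem Y z t s \<xi> = cdelta1 Y t s \<xi> - cdelta1 X t s \<xi> v* z s"

text \<open>The sum of the geometric series of ratio \<open>2 powr (1 - 2 * gam)\<close>, the total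
  cost of repeated halving.\<close>

definition Young_const :: real where
  "Young_const = 1 / (1 - 2 powr (1 - 2 * gam))"

text \<open>The integral is characterised by its remainder and not by a construction. The constant
  can stay existential, because \<open>Young_rem_bound\<close> replaces it by an explicit one as
  soon as \<open>z\<close> is Hoelder.\<close>

definition is_Young :: "(real \<Rightarrow> real^'m^'d) \<Rightarrow> (real \<Rightarrow> real \<Rightarrow> real^'m) \<Rightarrow> bool" where
  "is_Young z Y \<longleftrightarrow> (\<forall>t\<in>{0..T}. in_L (Y t)) \<and> N (Y 0) = 0 \<and>
     (\<exists>C. \<forall>s t. 0 \<le> s \<and> s < t \<and> t \<le> T \<longrightarrow> N (Young_rem Y z t s) \<le> C * (t - s) powr (2 * gam))"

lemma Young_const_pos: "0 < Young_const"
  using gam by (simp add: Young_const_def powr_less_one)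

text \<open>The increments of \<open>Y\<close> cancel by \<open>cdelta1_split\<close>, and those of
  \<open>X\<close> leave only the change of the coefficient. The defect is therefore the same for
  every candidate \<open>Y\<close>.\<close>

lemma cdelta2_Young_rem: "cdelta2 (Young_rem Y z) t u s \<xi> = cdelta1 X t u \<xi> v* (z u - z s)"
  unfolding cdelta2_def Young_rem_def cdelta1_split[of Y t s \<xi> u] cdelta1_split[of X t s \<xi> u]
  by (simp add: vector_matrix_left_distrib vector_matrix_mult_diff_distrib
      scaleR_vector_matrix_assoc scaleR_diff_right)

lemma X_delta_in: "0 \<le> s \<Longrightarrow> s \<le> t \<Longrightarrow> t \<le> T \<Longrightarrow> in_L (cdelta1 X t s)"
  using X_in by (intro L_cdelta1) auto

lemma Young_rem_in:
  assumes "0 \<le> s" "s \<le> t" "t \<le> T" "in_L (Y t)" "in_L (Y s)"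
  shows "in_L (Young_rem Y z t s)"
  unfolding Young_rem_def[abs_def] using assms
  by (intro L_diff(1) L_vector_matrix(1) X_delta_in L_cdelta1) auto

lemma N_cdelta2_Young_rem_le:
  assumes "0 \<le> s" "s \<le> u" "u \<le> t" "t \<le> T" "norm (z u - z s) \<le> H"
  shows "N (cdelta2 (Young_rem Y z) t u s) \<le> Cx * (t - u) powr gam * H"
proof -
  have "N (cdelta2 (Young_rem Y z) t u s) \<le> norm (z u - z s) * N (cdelta1 X t u)"
    unfolding cdelta2_Young_rem[abs_def] using assms by (intro L_vector_matrix(2) X_delta_in) auto
  also have "\<dots> \<le> H * (Cx * (t - u) powr gam)"
    using assms order_trans[OF norm_ge_zero assms(5)] by (intro mult_mono X_le) auto
  finally show ?thesis by (simp add: mult_ac)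
qed

text \<open>The a priori exponent \<open>\<mu>\<close> is arbitrary so that the lemma applies to
  elements produced by sewing. The Hoelder bound on \<open>z\<close> is asked for only between
  \<open>s\<close> and \<open>t\<close>, which lets \<open>H\<close> be a constant valid on short
  intervals.\<close>

lemma Young_rem_bound:
  assumes Y: "\<And>t. 0 \<le> t \<Longrightarrow> t \<le> T \<Longrightarrow> in_L (Y t)"
    and C: "\<And>s t. 0 \<le> s \<Longrightarrow> s < t \<Longrightarrow> t \<le> T \<Longrightarrow> N (Young_rem Y z t s) \<le> C * (t - s) powr \<mu>"
    and "1 < \<mu>" "0 \<le> H"
    and z: "\<And>p q. s \<le> p \<Longrightarrow> p \<le> q \<Longrightarrow> q \<le> t \<Longrightarrow> norm (z q - z p) \<le> H * (q - p) powr gam"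
    and "0 \<le> s" "s < t" "t \<le> T"
  shows "N (Young_rem Y z t s) \<le> Young_const * Cx * H * (t - s) powr (2 * gam)"
proof -
  have mid: "N (cdelta2 (Young_rem Y z) q ((p + q) / 2) p) \<le> (Cx * H) * (q - p) powr (2 * gam)"
    if "s \<le> p" "p < q" "q \<le> t" for p q
  proof -
    define m where "m = (p + q) / 2"
    have m: "p < m" "m < q" using that by (auto simp: m_def)
    have "N (cdelta2 (Young_rem Y z) q m p) \<le> Cx * (q - m) powr gam * (H * (m - p) powr gam)"
      using that m assms by (intro N_cdelta2_Young_rem_le z) auto
    also have "\<dots> \<le> Cx * (q - p) powr gam * (H * (q - p) powr gam)"
      using that m assms Cx gam by (intro mult_mono powr_mono2 mult_nonneg_nonneg) auto
    also have "\<dots> = (Cx * H) * (q - p) powr (2 * gam)"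
      by (simp add: powr_add[symmetric] mult_ac)
    finally show ?thesis unfolding m_def .
  qed
  have "N (Young_rem Y z t s) \<le> (Cx * H) / (1 - 2 powr (1 - 2 * gam)) * (t - s) powr (2 * gam)"
  proof (rule sewing_bound[where a = s and b = t and \<mu> = \<mu> and C = C])
    show "in_L (Young_rem Y z q p)" if "s \<le> p" "p < q" "q \<le> t" for p q
      using that assms by (intro Young_rem_in Y) auto
  qed (use assms Cx gam mid in auto)
  then show ?thesis by (simp add: Young_const_def)
qed

text \<open>The path \<open>X\<close> stopped at time \<open>r\<close> and then transported to time
  \<open>t\<close> by the exponential factor. For \<open>a \<le> b\<close>, the difference
  \<open>clamp t b - clamp t a\<close> is the contribution of the cell from \<open>a\<close> to
  \<open>b\<close> to an integral up to \<open>t\<close>. It vanishes when \<open>t \<le> a\<close>,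
  so sums over all cells need no cutoff at \<open>t\<close>.\<close>

definition clamp :: "real \<Rightarrow> real \<Rightarrow> real \<Rightarrow> real^'d" where
  "clamp t r \<xi> = exp (- \<xi> * (t - min t r)) *\<^sub>R X (min t r) \<xi>"

definition grid :: "nat \<Rightarrow> nat \<Rightarrow> real" where
  "grid n i = real i * T / 2 ^ n"

text \<open>The convolutional integral of the step function with value \<open>z (grid n i)\<close> on the \<open>i\<close>-th cell.\<close>

definition step_int :: "(real \<Rightarrow> real^'m^'d) \<Rightarrow> nat \<Rightarrow> real \<Rightarrow> real \<Rightarrow> real^'m" where
  "step_int z n t \<xi> = (\<Sum>i<2^n. (clamp t (grid n (Suc i)) \<xi> - clamp t (grid n i) \<xi>) v* z (grid n i))"

lemma grid_mono: "i \<le> j \<Longrightarrow> grid n i \<le> grid n j"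
  using T by (simp add: grid_def divide_right_mono)

lemma grid_nonneg [simp]: "0 \<le> grid n i"
  using T by (simp add: grid_def)

lemma grid_0 [simp]: "grid n 0 = 0"
  by (simp add: grid_def)

lemma grid_last [simp]: "grid n (2 ^ n) = T"
  by (simp add: grid_def)

lemma grid_Suc: "grid n (Suc i) = grid n i + T / 2 ^ n"
  by (simp add: grid_def field_simps)

lemma clamp_in: "0 \<le> t \<Longrightarrow> t \<le> T \<Longrightarrow> 0 \<le> r \<Longrightarrow> in_L (clamp t r)"
  unfolding clamp_def[abs_def] using X_in by (intro L_exp(1)) auto

lemma step_int_in: "0 \<le> t \<Longrightarrow> t \<le> T \<Longrightarrow> in_L (step_int z n t)"
  unfolding step_int_def[abs_def] by (intro L_sum L_vector_matrix(1) L_diff(1) clamp_in) auto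

lemma step_int_0: "step_int z n 0 = (\<lambda>\<xi>. 0)"
  by (simp add: step_int_def[abs_def] clamp_def)

lemma exp_clamp: "s \<le> t \<Longrightarrow> exp (- \<xi> * (t - s)) *\<^sub>R clamp s r \<xi> = clamp t (min s r) \<xi>"
  unfolding clamp_def scaleR_scaleR exp_neg_split[symmetric] by (simp add: min_def)

lemma cdelta1_step_int:
  assumes j: "j < 2 ^ n" and s: "grid n j \<le> s" "s \<le> t" and t: "t \<le> grid n (Suc j)"
  shows "cdelta1 (step_int z n) t s \<xi> = cdelta1 X t s \<xi> v* z (grid n j)"
proof -
  \<comment> \<open>\<open>G\<close> is constantly zero up to \<open>s\<close> and constantly the
    full increment of \<open>X\<close> from \<open>t\<close> on. As \<open>s\<close> and
    \<open>t\<close> lie in cell \<open>j\<close>, only that cell sees it change.\<close>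
  define G where "G r = clamp t r \<xi> - clamp t (min s r) \<xi>" for r
  have "cdelta1 (step_int z n) t s \<xi> = (\<Sum>i<2^n. (G (grid n (Suc i)) - G (grid n i)) v* z (grid n i))"
    unfolding cdelta1_def step_int_def scaleR_sum_right sum_subtractf[symmetric]
    by (rule sum.cong)
       (simp_all only: G_def exp_clamp[OF s(2), symmetric] vector_matrix_mult_diff_rdistrib
         scaleR_diff_right scaleR_vector_matrix_assoc[symmetric], simp)
  also have "\<dots> = (\<Sum>i<2^n. if i = j then cdelta1 X t s \<xi> v* z (grid n j) else 0)"
  proof (rule sum.cong[OF refl])
    fix i assume "i \<in> {..<(2::nat)^n}"
    have lo: "G r = 0" if "r \<le> s" for r using that by (simp add: G_def min_absorb2)
    have hi: "G r = cdelta1 X t s \<xi>" if "t \<le> r" for r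
      using that s by (simp add: G_def clamp_def cdelta1_def min_absorb1)
    consider "i < j" | "i = j" | "j < i" by linarith
    then show "(G (grid n (Suc i)) - G (grid n i)) v* z (grid n i)
        = (if i = j then cdelta1 X t s \<xi> v* z (grid n j) else 0)"
    proof cases
      case 1
      then have "grid n (Suc i) \<le> s" "grid n i \<le> s"
        using s grid_mono[of "Suc i" j n] grid_mono[of i j n] by auto
      with 1 show ?thesis by (simp add: lo)
    next
      case 2
      then show ?thesis using s t by (simp add: lo hi)
    next
      case 3
      then have "t \<le> grid n (Suc i)" "t \<le> grid n i"
        using t grid_mono[of "Suc j" "Suc i" n] grid_mono[of "Suc j" i n] by auto
      with 3 show ?thesis by (simp add: hi)
    qed
  qed
  also have "\<dots> = cdelta1 X t s \<xi> v* z (grid n j)" using j by simp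
  finally show ?thesis .
qed

lemma Young_rem_diag: "Young_rem Y z t t = (\<lambda>\<xi>. 0)"
  by (simp add: Young_rem_def[abs_def] cdelta1_def)

text \<open>Within one cell the remainder is an increment of \<open>X\<close> times the change of
  \<open>z\<close> since the left grid point. Each factor is at most a multiple of the mesh to the
  power \<open>gam\<close>.\<close>

lemma step_int_rem_cell:
  assumes j: "j < 2 ^ n" and s: "grid n j \<le> s" "s \<le> t" and t: "t \<le> grid n (Suc j)" and "0 \<le> H"
    and z: "\<And>p q. 0 \<le> p \<Longrightarrow> p \<le> q \<Longrightarrow> q \<le> T \<Longrightarrow> norm (z q - z p) \<le> H * (q - p) powr gam"
  shows "N (Young_rem (step_int z n) z t s) \<le> Cx * H * (T / 2 ^ n) powr (2 * gam)"
proof -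
  have "grid n (Suc j) \<le> T" using grid_mono[of "Suc j" "2^n" n] j by simp
  then have st: "0 \<le> s" "t \<le> T" using s t order_trans[OF grid_nonneg s(1)] by auto
  have eq: "Young_rem (step_int z n) z t s = (\<lambda>\<xi>. cdelta1 X t s \<xi> v* (z (grid n j) - z s))"
    by (rule ext) (simp add: cdelta1_step_int[OF j s t] Young_rem_def vector_matrix_mult_diff_distrib)
  have "N (Young_rem (step_int z n) z t s) \<le> norm (z (grid n j) - z s) * N (cdelta1 X t s)"
    unfolding eq using s st by (intro L_vector_matrix(2) X_delta_in) auto
  also have "\<dots> \<le> (H * (s - grid n j) powr gam) * (Cx * (t - s) powr gam)"
    using s st z[of "grid n j" s] \<open>0 \<le> H\<close>
    by (intro mult_mono X_le) (auto simp: norm_minus_commute)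
  also have "\<dots> \<le> (H * (T / 2 ^ n) powr gam) * (Cx * (T / 2 ^ n) powr gam)"
    using s t \<open>0 \<le> H\<close> Cx gam unfolding grid_Suc
    by (intro mult_mono powr_mono2 mult_nonneg_nonneg) auto
  also have "\<dots> = Cx * H * (T / 2 ^ n) powr (2 * gam)"
    by (simp add: powr_add[symmetric] mult_ac)
  finally show ?thesis .
qed

lemma grid_cell:
  assumes "0 \<le> s" "s < T"
  obtains i where "i < 2 ^ n" "grid n i \<le> s" "s < grid n (Suc i)"
proof -
  define h where "h = T / 2 ^ n"
  have h: "0 < h" using T by (simp add: h_def)
  define i where "i = nat \<lfloor>s / h\<rfloor>"
  have i: "real i \<le> s / h" "s / h < real (Suc i)"
  proof -
    have "real i = of_int \<lfloor>s / h\<rfloor>" using assms h by (simp add: i_def)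
    then show "real i \<le> s / h" "s / h < real (Suc i)"
      using of_int_floor_le[of "s / h"] real_of_int_floor_add_one_gt[of "s / h"] unfolding of_nat_Suc by linarith+
  qed
  have g: "grid n k = real k * h" for k by (simp add: grid_def h_def)
  have 1: "grid n i \<le> s" "s < grid n (Suc i)" using i h unfolding g by (auto simp: field_simps)
  have "grid n i < grid n (2 ^ n)" using 1 assms by simp
  then have "i < 2 ^ n" using grid_mono[of "2 ^ n" i n] by (meson not_le)
  with 1 show ?thesis using that by blast
qed

text \<open>Below the mesh a step integral does not have a remainder of order
  \<open>(t - s) powr (2 * gam)\<close>, so the bound is expressed through a dyadic scale
  \<open>T / 2 ^ k\<close> not finer than the mesh. The induction starts at the mesh and doubles the
  scale, splitting at midpoints; the constant does not depend on \<open>n\<close>.\<close>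

lemma step_int_rem_bound:
  assumes H: "0 \<le> H"
    and z: "\<And>p q. 0 \<le> p \<Longrightarrow> p \<le> q \<Longrightarrow> q \<le> T \<Longrightarrow> norm (z q - z p) \<le> H * (q - p) powr gam"
    and "k \<le> n" "0 \<le> s" "s \<le> t" "t \<le> T" "t - s \<le> T / 2 ^ k"
  shows "N (Young_rem (step_int z n) z t s) \<le> (3 + Young_const) * (Cx * H) * (T / 2 ^ k) powr (2 * gam)"
  using assms(3-)
proof (induction k arbitrary: s t rule: inc_induct)
  case base
  let ?E = "Young_rem (step_int z n) z"
  let ?h = "T / 2 ^ n"
  let ?c = "Cx * H * ?h powr (2 * gam)"
  have c: "0 \<le> ?c" using Cx H by simp
  \<comment> \<open>An interval no longer than the mesh meets at most two cells: two cell remainders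
    and one defect at the grid point between them.\<close>
  have "N (?E t s) \<le> 3 * ?c"
  proof (cases "s = t")
    case True
    then show ?thesis using c by (simp add: Young_rem_diag)
  next
    case False
    with base have "s < t" "s < T" by auto
    then obtain i where i: "i < 2 ^ n" "grid n i \<le> s" "s < grid n (Suc i)"
      using grid_cell base by blast
    show ?thesis
    proof (cases "t \<le> grid n (Suc i)")
      case True
      have "N (?E t s) \<le> ?c" by (rule step_int_rem_cell[OF i(1,2) base(2) True H z])
      with c show ?thesis by linarith
    next
      case gt: False
      define g where "g = grid n (Suc i)"
      have g: "s < g" "g < t" using gt i by (auto simp: g_def)
      have "grid n (Suc i) < grid n (2 ^ n)" using gt base by simp
      then have i': "Suc i < 2 ^ n" using grid_mono[of "2 ^ n" "Suc i" n] by (meson not_le)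
      have tg: "t \<le> grid n (Suc (Suc i))" using base i unfolding grid_Suc by linarith
      have 1: "N (?E t g) \<le> ?c"
        by (rule step_int_rem_cell[OF i' _ _ tg H z]) (use g in \<open>auto simp: g_def\<close>)
      have 2: "N (?E g s) \<le> ?c"
        by (rule step_int_rem_cell[OF i(1,2) _ _ H z]) (use g in \<open>auto simp: g_def\<close>)
      have "N (cdelta2 ?E t g s) \<le> Cx * (t - g) powr gam * (H * (g - s) powr gam)"
        using g base by (intro N_cdelta2_Young_rem_le z) auto
      also have "\<dots> \<le> Cx * ?h powr gam * (H * ?h powr gam)"
        using g base Cx gam H by (intro mult_mono powr_mono2 mult_nonneg_nonneg) auto
      also have "\<dots> = ?c" by (simp add: powr_add[symmetric] mult_ac)
      finally have 3: "N (cdelta2 ?E t g s) \<le> ?c" .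
      have "N (?E t s) \<le> N (cdelta2 ?E t g s) + N (?E t g) + N (?E g s)"
        using g base by (intro N_le_cdelta2 Young_rem_in step_int_in) auto
      with 1 2 3 show ?thesis by linarith
    qed
  qed
  also have "\<dots> \<le> (3 + Young_const) * ?c"
    using c Young_const_pos by (intro mult_right_mono) auto
  finally show ?case by (simp add: mult.assoc)
next
  case (step k)
  let ?E = "Young_rem (step_int z n) z"
  define d where "d = T / 2 ^ k"
  have d: "0 < d" "T / 2 ^ Suc k = d / 2" using T by (auto simp: d_def)
  define m where "m = (s + t) / 2"
  have m: "s \<le> m" "m \<le> t" "t - m \<le> d / 2" "m - s \<le> d / 2"
    using step.prems by (auto simp: m_def d_def field_simps)
  define P where "P = (3 + Young_const) * (Cx * H)"
  have CH: "0 \<le> Cx * H" using Cx H by simp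
  have "N (cdelta2 ?E t m s) \<le> Cx * (t - m) powr gam * (H * (m - s) powr gam)"
    using m step.prems by (intro N_cdelta2_Young_rem_le z) auto
  also have "\<dots> \<le> Cx * (d / 2) powr gam * (H * (d / 2) powr gam)"
    using m Cx gam H by (intro mult_mono powr_mono2 mult_nonneg_nonneg) auto
  also have "\<dots> = Cx * H * (d / 2) powr (2 * gam)" by (simp add: powr_add[symmetric] mult_ac)
  finally have 3: "N (cdelta2 ?E t m s) \<le> Cx * H * (d / 2) powr (2 * gam)" .
  have IH: "N (?E q p) \<le> P * (d / 2) powr (2 * gam)" if "0 \<le> p" "p \<le> q" "q \<le> T" "q - p \<le> d / 2" for p q
    using step.IH[OF that(1-3)] that(4) unfolding d P_def by blast
  have "N (?E t s) \<le> N (cdelta2 ?E t m s) + N (?E t m) + N (?E m s)"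
    using m step.prems by (intro N_le_cdelta2 Young_rem_in step_int_in) auto
  also have "\<dots> \<le> (Cx * H + 2 * P) * (d / 2) powr (2 * gam)"
    using 3 IH[of m t] IH[of s m] m step.prems by (simp add: distrib_right)
  also have "\<dots> = ((Cx * H) * 2 powr (- (2 * gam)) + P * 2 powr (1 - 2 * gam)) * d powr (2 * gam)"
    using d by (simp add: powr_divide powr_diff powr_minus field_simps)
  \<comment> \<open>The summand \<open>Young_const\<close> in \<open>P\<close> pays for the defect:
    \<open>Young_const * (1 - r) = 1\<close>, so \<open>P * (1 - r)\<close> is at least
    \<open>Cx * H\<close>.\<close>
  also have "\<dots> \<le> P * d powr (2 * gam)"
  proof (rule mult_right_mono)
    define r where "r = (2::real) powr (1 - 2 * gam)"
    have r: "0 < r" "r < 1" using gam by (auto simp: r_def powr_less_one)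
    have "(Cx * H) * 2 powr (- (2 * gam)) \<le> Cx * H * 1"
      using CH gam powr_mono[of "- (2 * gam)" 0 2] by (intro mult_left_mono) auto
    also have "\<dots> = (Young_const * (Cx * H)) * (1 - r)"
      using r by (simp add: Young_const_def r_def[symmetric])
    also have "\<dots> \<le> P * (1 - r)"
      unfolding P_def using r CH by (intro mult_right_mono) auto
    finally show "(Cx * H) * 2 powr (- (2 * gam)) + P * 2 powr (1 - 2 * gam) \<le> P"
      by (simp add: r_def algebra_simps)
  qed simp
  finally show ?case unfolding P_def d_def .
qed

text \<open>From the left end \<open>g\<close> of a cell of level \<open>n\<close>, the coarse
  increment is exactly \<open>cdelta1 X t g v* z g\<close>. The two levels therefore differ over
  that cell by the remainder of the finer step integral, and \<open>i\<close> cells add up to the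
  factor \<open>i\<close>.\<close>

lemma step_int_Suc_diff:
  assumes H: "0 \<le> H"
    and z: "\<And>p q. 0 \<le> p \<Longrightarrow> p \<le> q \<Longrightarrow> q \<le> T \<Longrightarrow> norm (z q - z p) \<le> H * (q - p) powr gam"
    and "i \<le> 2 ^ n" "0 \<le> t" "t \<le> grid n i"
  shows "N (\<lambda>\<xi>. step_int z (Suc n) t \<xi> - step_int z n t \<xi>)
    \<le> real i * ((3 + Young_const) * (Cx * H) * (T / 2 ^ n) powr (2 * gam))"
  using assms(3-)
proof (induction i arbitrary: t)
  case 0
  then have "t = 0" by simp
  then show ?case by (simp add: step_int_0)
next
  case (Suc i)
  let ?D = "\<lambda>t \<xi>. step_int z (Suc n) t \<xi> - step_int z n t \<xi>"
  let ?c = "(3 + Young_const) * (Cx * H) * (T / 2 ^ n) powr (2 * gam)"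
  have c: "0 \<le> ?c" using Cx H Young_const_pos by simp
  show ?case
  proof (cases "t \<le> grid n i")
    case True
    then have "N (?D t) \<le> real i * ?c" using Suc by simp
    with c show ?thesis by (simp add: distrib_right)
  next
    case False
    define g where "g = grid n i"
    have g: "0 \<le> g" "g < t" using False by (auto simp: g_def)
    have tT: "t \<le> T" using Suc.prems grid_mono[of "Suc i" "2 ^ n" n] by simp
    have D: "in_L (?D t)" if "0 \<le> t" "t \<le> T" for t using that by (intro L_diff step_int_in)
    have "cdelta1 (step_int z n) t g \<xi> = cdelta1 X t g \<xi> v* z g" for \<xi>
      unfolding g_def by (rule cdelta1_step_int) (use Suc.prems False in auto)
    then have "cdelta1 ?D t g = Young_rem (step_int z (Suc n)) z t g"
      by (auto simp: Young_rem_def cdelta1_def algebra_simps)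
    moreover have "N (Young_rem (step_int z (Suc n)) z t g) \<le> ?c"
      using g tT Suc.prems unfolding grid_Suc g_def
      by (intro step_int_rem_bound[OF H z]) auto
    moreover have "N (?D t) \<le> N (?D g) + N (cdelta1 ?D t g)"
      using g tT by (intro N_le_cdelta1 D) auto
    moreover have "N (?D g) \<le> real i * ?c"
      using Suc.prems g by (intro Suc.IH) (auto simp: g_def)
    ultimately show ?thesis by (simp add: distrib_right)
  qed
qed

theorem Young_exists:
  assumes H: "0 \<le> H"
    and z: "\<And>p q. 0 \<le> p \<Longrightarrow> p \<le> q \<Longrightarrow> q \<le> T \<Longrightarrow> norm (z q - z p) \<le> H * (q - p) powr gam"
  shows "\<exists>Y. is_Young z Y"
proof -
  define P where "P = (3 + Young_const) * (Cx * H)"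
  have P: "0 \<le> P" using Cx H Young_const_pos by (simp add: P_def)
  define r where "r = (2::real) powr (1 - 2 * gam)"
  have r: "0 < r" "r < 1" using gam by (auto simp: r_def powr_less_one)
  have step: "N (\<lambda>\<xi>. step_int z (Suc n) t \<xi> - step_int z n t \<xi>) \<le> P * T powr (2 * gam) * r ^ n"
    if "0 \<le> t" "t \<le> T" for t n
  proof -
    have "N (\<lambda>\<xi>. step_int z (Suc n) t \<xi> - step_int z n t \<xi>) \<le> real (2 ^ n) * (P * (T / 2 ^ n) powr (2 * gam))"
      unfolding P_def using that by (intro step_int_Suc_diff[OF H z]) auto
    \<comment> \<open>One factor \<open>1 / 2 ^ n\<close> cancels the number of cells; what remains
      is geometric with ratio \<open>r < 1\<close>.\<close>
    also have "(T / 2 ^ n) powr (2 * gam) = T powr (2 * gam) / 2 ^ n * r ^ n"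
      using T by (simp add: r_def powr_divide powr_diff powr_power powr_realpow[symmetric] powr_powr
          field_simps powr_add[symmetric])
    finally show ?thesis by (simp add: field_simps)
  qed
  have "\<exists>f. in_L f \<and> (\<lambda>n. N (\<lambda>\<xi>. f \<xi> - step_int z n t \<xi>)) \<longlonglongrightarrow> 0" if "0 \<le> t" "t \<le> T" for t
    by (rule L_complete[where c = "\<lambda>n. P * T powr (2 * gam) * r ^ n"])
       (use that r step step_int_in in auto)
  then obtain Y where Y: "\<And>t. 0 \<le> t \<Longrightarrow> t \<le> T \<Longrightarrow> in_L (Y t)"
    and lim: "\<And>t. 0 \<le> t \<Longrightarrow> t \<le> T \<Longrightarrow> (\<lambda>n. N (\<lambda>\<xi>. Y t \<xi> - step_int z n t \<xi>)) \<longlonglongrightarrow> 0"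
    by metis
  have "N (Y 0) = 0" using lim[of 0] T by (simp add: step_int_0 LIMSEQ_const_iff)
  moreover have "N (Young_rem Y z t s) \<le> P * 2 powr (2 * gam) * (t - s) powr (2 * gam)"
    if st: "0 \<le> s" "s < t" "t \<le> T" for s t
  proof -
    have ex: "\<exists>k. T / 2 ^ Suc k < t - s"
    proof -
      obtain k where "T / (t - s) < 2 ^ k" using real_arch_pow[of 2 "T / (t - s)"] by auto
      then have "T / 2 ^ k < t - s" using st by (simp add: field_simps)
      moreover have "T / 2 ^ Suc k \<le> T / 2 ^ k" using T by (simp add: field_simps)
      ultimately show ?thesis by (intro exI[of _ k]) linarith
    qed
    \<comment> \<open>The dyadic scale comparable to the interval,
      \<open>T / 2 ^ Suc k < t - s \<le> T / 2 ^ k\<close>. It stays fixed while \<open>n\<close>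
      tends to infinity, and replacing it by \<open>t - s\<close> costs the factor
      \<open>2 powr (2 * gam)\<close>.\<close>
    define k where "k = (LEAST k. T / 2 ^ Suc k < t - s)"
    have k1: "T / 2 ^ Suc k < t - s" unfolding k_def by (rule LeastI_ex[OF ex])
    have k2: "t - s \<le> T / 2 ^ k"
    proof (cases k)
      case 0
      then show ?thesis using st by simp
    next
      case (Suc l)
      then show ?thesis using not_less_Least[of l "\<lambda>k. T / 2 ^ Suc k < t - s"]
        unfolding k_def[symmetric] by simp
    qed
    let ?e = "\<lambda>n. N (\<lambda>\<xi>. Y t \<xi> - step_int z n t \<xi>) + N (\<lambda>\<xi>. Y s \<xi> - step_int z n s \<xi>)"
    have bd: "N (Young_rem Y z t s) \<le> P * (T / 2 ^ k) powr (2 * gam) + ?e n" if "k \<le> n" for n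
    proof -
      let ?D = "\<lambda>t \<xi>. Y t \<xi> - step_int z n t \<xi>"
      have D: "in_L (?D t)" "in_L (?D s)" using st Y by (auto intro!: L_diff step_int_in)
      have "Young_rem Y z t s = (\<lambda>\<xi>. Young_rem (step_int z n) z t s \<xi> + cdelta1 ?D t s \<xi>)"
        by (auto simp: Young_rem_def cdelta1_def algebra_simps)
      moreover have "N (\<lambda>\<xi>. Young_rem (step_int z n) z t s \<xi> + cdelta1 ?D t s \<xi>)
          \<le> N (Young_rem (step_int z n) z t s) + N (cdelta1 ?D t s)"
        using st D by (intro L_add(2) Young_rem_in step_int_in L_cdelta1) auto
      moreover have "N (Young_rem (step_int z n) z t s) \<le> P * (T / 2 ^ k) powr (2 * gam)"
        unfolding P_def using st k2 that by (intro step_int_rem_bound[OF H z]) auto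
      moreover have "N (cdelta1 ?D t s) \<le> ?e n"
      proof -
        have "N (cdelta1 ?D t s) \<le> N (?D t) + N (\<lambda>\<xi>. exp (- \<xi> * (t - s)) *\<^sub>R ?D s \<xi>)"
          unfolding cdelta1_def[abs_def] using st D by (intro L_diff(2) L_exp(1)) auto
        also have "\<dots> \<le> ?e n" using st D by (intro add_left_mono L_exp(2)) auto
        finally show ?thesis .
      qed
      ultimately show ?thesis by simp
    qed
    have "(\<lambda>n. P * (T / 2 ^ k) powr (2 * gam) + ?e n) \<longlonglongrightarrow> P * (T / 2 ^ k) powr (2 * gam) + (0 + 0)"
      using st by (intro tendsto_add tendsto_const lim) auto
    then have "N (Young_rem Y z t s) \<le> P * (T / 2 ^ k) powr (2 * gam) + (0 + 0)"
      by (rule LIMSEQ_le_const) (use bd in auto)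
    also have "\<dots> \<le> P * (2 * (t - s)) powr (2 * gam)"
      using k1 P T gam by (auto intro!: mult_left_mono powr_mono2)
    also have "\<dots> = P * 2 powr (2 * gam) * (t - s) powr (2 * gam)"
      using st by (subst powr_mult) auto
    finally show ?thesis .
  qed
  ultimately have "is_Young z Y" unfolding is_Young_def using Y by auto
  then show ?thesis by blast
qed

end

subsection \<open>Estimates for the solution map\<close>

text \<open>A discrete Gronwall argument. Going back by \<open>e\<close> divides
  \<open>exp (t / e)\<close> by \<open>exp 1 \<ge> 2\<close>, so the accumulated contributions are
  dominated by a geometric series of ratio 1/2. The resulting factor 2 is independent of the number
  of steps.\<close>

lemma exp_growth:
  fixes f :: "real \<Rightarrow> real"
  assumes "0 < e" "0 \<le> c" "f 0 \<le> 0"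
    and step: "\<And>s t. 0 \<le> s \<Longrightarrow> s \<le> t \<Longrightarrow> t \<le> T \<Longrightarrow> t - s \<le> e \<Longrightarrow> f t \<le> f s + c * exp (t / e)"
    and "0 \<le> t" "t \<le> T"
  shows "f t \<le> 2 * c * exp (t / e)"
proof -
  obtain n :: nat where "t / e < real n" using reals_Archimedean2 by blast
  then have "t \<le> real n * e" using \<open>0 < e\<close> by (simp add: field_simps)
  then show ?thesis using assms(5,6)
  proof (induction n arbitrary: t)
    case 0
    then have "t = 0" by simp
    then show ?case using assms by simp
  next
    case (Suc n)
    show ?case
    proof (cases "t \<le> e")
      case True
      have "f t \<le> f 0 + c * exp (t / e)" using step[of 0 t] Suc.prems True by simp
      moreover have "0 \<le> c * exp (t / e)" using assms by simp
      ultimately show ?thesis using assms(3) by linarith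
    next
      case False
      have "f t \<le> f (t - e) + c * exp (t / e)"
        using step[of "t - e" t] Suc.prems False assms by simp
      also have "f (t - e) \<le> 2 * c * exp ((t - e) / e)"
        using Suc.prems False assms by (intro Suc.IH) (auto simp: algebra_simps)
      also have "exp ((t - e) / e) \<le> exp (t / e) / 2"
      proof -
        have "exp ((t - e) / e) = exp (t / e) / exp 1"
          using assms by (simp add: diff_divide_distrib exp_diff)
        also have "\<dots> \<le> exp (t / e) / 2"
          using exp_ge_add_one_self[of 1] by (intro divide_left_mono) auto
        finally show ?thesis .
      qed
      finally show ?thesis using assms by (simp add: mult_left_mono)
    qed
  qed
qed

text \<open>The counterpart without weight, where the number of steps does appear.\<close>

lemma linear_growth:
  fixes f :: "real \<Rightarrow> real"
  assumes "0 < e" "0 \<le> c" "f 0 \<le> 0"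
    and step: "\<And>s t. 0 \<le> s \<Longrightarrow> s \<le> t \<Longrightarrow> t \<le> T \<Longrightarrow> t - s \<le> e \<Longrightarrow> f t \<le> f s + c"
    and "0 \<le> t" "t \<le> T"
  shows "f t \<le> c * (t / e + 1)"
proof -
  obtain n :: nat where "t / e < real n" using reals_Archimedean2 by blast
  then have "t \<le> real n * e" using \<open>0 < e\<close> by (simp add: field_simps)
  then show ?thesis using assms(5,6)
  proof (induction n arbitrary: t)
    case 0
    then have "t = 0" by simp
    then show ?case using assms by simp
  next
    case (Suc n)
    show ?case
    proof (cases "t \<le> e")
      case True
      have "f t \<le> f 0 + c" using step[of 0 t] Suc.prems True by simp
      then have "f t \<le> c * 1" using assms(3) by simp
      also have "\<dots> \<le> c * (t / e + 1)" using Suc.prems assms by (intro mult_left_mono) auto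
      finally show ?thesis .
    next
      case False
      have "f t \<le> f (t - e) + c"
        using step[of "t - e" t] Suc.prems False assms by simp
      also have "f (t - e) \<le> c * ((t - e) / e + 1)"
        using Suc.prems False assms by (intro Suc.IH) (auto simp: algebra_simps)
      finally show ?thesis using assms by (simp add: field_simps)
    qed
  qed
qed

section \<open>Linearity and increment bounds of the integral\<close>

context Young_driver
begin

lemma is_Young_in: "is_Young z Y \<Longrightarrow> 0 \<le> t \<Longrightarrow> t \<le> T \<Longrightarrow> in_L (Y t)"
  by (auto simp: is_Young_def)

lemma is_Young_phi_int_0:
  assumes "is_Young z Y"
  shows "phi_int (Y 0) = 0"
  using norm_phi_int_le[of "Y 0"] assms gam T by (auto simp: is_Young_def)

text \<open>Needed for the fixed point, whose identity is known only for times between 0 and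
  \<open>T\<close>.\<close>

lemma is_Young_cong:
  assumes "\<And>t. 0 \<le> t \<Longrightarrow> t \<le> T \<Longrightarrow> z t = z' t"
  shows "is_Young z Y \<longleftrightarrow> is_Young z' Y"
proof -
  have "Young_rem Y z t s = Young_rem Y z' t s" if "0 \<le> s" "s < t" "t \<le> T" for s t
    using assms[of s] that by (auto simp: Young_rem_def)
  then show ?thesis by (auto simp: is_Young_def)
qed

text \<open>By linearity the difference of two images of the solution map is itself an integral, so
  the contraction estimate is an increment bound with coefficient \<open>z - z'\<close>.\<close>

lemma is_Young_diff:
  assumes Y: "is_Young z Y" and Y': "is_Young z' Y'"
  shows "is_Young (\<lambda>t. z t - z' t) (\<lambda>t \<xi>. Y t \<xi> - Y' t \<xi>)"
proof -
  obtain C where C: "\<And>s t. 0 \<le> s \<Longrightarrow> s < t \<Longrightarrow> t \<le> T \<Longrightarrow> N (Young_rem Y z t s) \<le> C * (t - s) powr (2 * gam)"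
    using Y by (auto simp: is_Young_def)
  obtain C' where C': "\<And>s t. 0 \<le> s \<Longrightarrow> s < t \<Longrightarrow> t \<le> T \<Longrightarrow> N (Young_rem Y' z' t s) \<le> C' * (t - s) powr (2 * gam)"
    using Y' by (auto simp: is_Young_def)
  note in1 = is_Young_in[OF Y] and in2 = is_Young_in[OF Y']
  have eq: "Young_rem (\<lambda>t \<xi>. Y t \<xi> - Y' t \<xi>) (\<lambda>t. z t - z' t) t s
      = (\<lambda>\<xi>. Young_rem Y z t s \<xi> - Young_rem Y' z' t s \<xi>)" for t s
    by (rule ext) (simp add: Young_rem_def cdelta1_def vector_matrix_mult_diff_distrib scaleR_diff_right)
  have "N (Young_rem (\<lambda>t \<xi>. Y t \<xi> - Y' t \<xi>) (\<lambda>t. z t - z' t) t s) \<le> (C + C') * (t - s) powr (2 * gam)"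
    if "0 \<le> s" "s < t" "t \<le> T" for s t
  proof -
    have "N (\<lambda>\<xi>. Young_rem Y z t s \<xi> - Young_rem Y' z' t s \<xi>)
        \<le> N (Young_rem Y z t s) + N (Young_rem Y' z' t s)"
      using that in1 in2 by (intro L_diff(2) Young_rem_in) auto
    with C[OF that] C'[OF that] show ?thesis unfolding eq distrib_right by linarith
  qed
  moreover have "N (\<lambda>\<xi>. Y 0 \<xi> - Y' 0 \<xi>) = 0"
  proof -
    have "N (\<lambda>\<xi>. Y 0 \<xi> - Y' 0 \<xi>) \<le> N (Y 0) + N (Y' 0)"
      using in1 in2 T by (intro L_diff(2)) auto
    also have "\<dots> = 0" using Y Y' by (simp add: is_Young_def)
    finally show ?thesis using N_nonneg by (intro antisym)
  qed
  moreover have "in_L (\<lambda>\<xi>. Y t \<xi> - Y' t \<xi>)" if "0 \<le> t" "t \<le> T" for t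
    using that in1 in2 by (intro L_diff(1)) auto
  ultimately show ?thesis unfolding is_Young_def by (auto intro!: exI[of _ "C + C'"])
qed

lemma N_cdelta1_le_Young_rem:
  assumes st: "0 \<le> s" "s \<le> t" "t \<le> T" and Y: "in_L (Y t)" "in_L (Y s)" and K: "norm (z s) \<le> K"
  shows "N (cdelta1 Y t s) \<le> N (Young_rem Y z t s) + K * Cx * (t - s) powr gam"
proof -
  have "N (\<lambda>\<xi>. cdelta1 X t s \<xi> v* z s) \<le> norm (z s) * N (cdelta1 X t s)"
    using st by (intro L_vector_matrix(2) X_delta_in)
  also have "\<dots> \<le> K * (Cx * (t - s) powr gam)"
    using st K order_trans[OF norm_ge_zero K] by (intro mult_mono X_le) auto
  finally have "N (\<lambda>\<xi>. cdelta1 X t s \<xi> v* z s) \<le> K * Cx * (t - s) powr gam" by (simp add: mult.assoc)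
  moreover have "N (\<lambda>\<xi>. Young_rem Y z t s \<xi> + cdelta1 X t s \<xi> v* z s)
      \<le> N (Young_rem Y z t s) + N (\<lambda>\<xi>. cdelta1 X t s \<xi> v* z s)"
    using st Y by (intro L_add(2) Young_rem_in L_vector_matrix(1) X_delta_in) auto
  moreover have "cdelta1 Y t s = (\<lambda>\<xi>. Young_rem Y z t s \<xi> + cdelta1 X t s \<xi> v* z s)"
    by (auto simp: Young_rem_def)
  ultimately show ?thesis by simp
qed

lemma cdelta1_diag: "cdelta1 Y t t = (\<lambda>\<xi>. 0)"
  by (auto simp: cdelta1_def)

text \<open>The size of \<open>z\<close> enters only at the left end and its Hoelder constant only
  between \<open>s\<close> and \<open>t\<close>. This locality allows constants that depend on
  \<open>t\<close>, such as those with the weight \<open>exp (t / e)\<close>.\<close>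

lemma is_Young_increment_le:
  assumes Y: "is_Young z Y" and "0 \<le> s" "s \<le> t" "t \<le> T" "0 \<le> H" "norm (z s) \<le> K"
    and z: "\<And>p q. s \<le> p \<Longrightarrow> p \<le> q \<Longrightarrow> q \<le> t \<Longrightarrow> norm (z q - z p) \<le> H * (q - p) powr gam"
  shows "N (cdelta1 Y t s) \<le> Cx * (K + Young_const * H * (t - s) powr gam) * (t - s) powr gam"
proof (cases "s = t")
  case True
  then show ?thesis by (simp add: cdelta1_diag)
next
  case False
  note in_Y = is_Young_in[OF Y]
  obtain C where C: "\<And>s t. 0 \<le> s \<Longrightarrow> s < t \<Longrightarrow> t \<le> T \<Longrightarrow> N (Young_rem Y z t s) \<le> C * (t - s) powr (2 * gam)"
    using Y by (auto simp: is_Young_def)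
  have "N (Young_rem Y z t s) \<le> Young_const * Cx * H * (t - s) powr (2 * gam)"
    by (rule Young_rem_bound[where \<mu> = "2 * gam" and C = C]) (use False assms gam C in_Y in auto)
  also have "(t - s) powr (2 * gam) = (t - s) powr gam * (t - s) powr gam"
    by (simp add: powr_add[symmetric])
  finally have "N (Young_rem Y z t s) \<le> Young_const * Cx * H * ((t - s) powr gam * (t - s) powr gam)" .
  moreover have "N (cdelta1 Y t s) \<le> N (Young_rem Y z t s) + K * Cx * (t - s) powr gam"
    using assms in_Y by (intro N_cdelta1_le_Young_rem) auto
  ultimately show ?thesis by (simp add: algebra_simps)
qed

text \<open>A qualitative bound resting on the existential constant of \<open>is_Young\<close>: it
  asks for a bounded coefficient but for no regularity of it, and so gives the Hoelder continuity of
  a solution's path before anything else is known about it.\<close>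

lemma is_Young_holder:
  assumes Y: "is_Young z Y" and K: "\<And>t. norm (z t) \<le> K"
  obtains C where "0 \<le> C"
    "\<And>s t. 0 \<le> s \<Longrightarrow> s \<le> t \<Longrightarrow> t \<le> T \<Longrightarrow> N (cdelta1 Y t s) \<le> C * (t - s) powr gam"
    "\<And>t. 0 \<le> t \<Longrightarrow> t \<le> T \<Longrightarrow> N (Y t) \<le> C"
    "\<And>s t. 0 \<le> s \<Longrightarrow> s \<le> t \<Longrightarrow> t \<le> T \<Longrightarrow> norm (phi_int (Y t) - phi_int (Y s)) \<le> C * (t - s) powr gam"
proof -
  note in_Y = is_Young_in[OF Y]
  obtain C0 where C0: "\<And>s t. 0 \<le> s \<Longrightarrow> s < t \<Longrightarrow> t \<le> T \<Longrightarrow> N (Young_rem Y z t s) \<le> C0 * (t - s) powr (2 * gam)"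
    using Y by (auto simp: is_Young_def)
  have K0: "0 \<le> K" using order_trans[OF norm_ge_zero K] .
  define C1 where "C1 = \<bar>C0\<bar> * T powr gam + K * Cx"
  have C1: "0 \<le> C1" using K0 Cx by (simp add: C1_def)
  have a: "N (cdelta1 Y t s) \<le> C1 * (t - s) powr gam" if st: "0 \<le> s" "s \<le> t" "t \<le> T" for s t
  proof (cases "s = t")
    case True
    then show ?thesis by (simp add: cdelta1_diag)
  next
    case False
    have "N (Young_rem Y z t s) \<le> C0 * (t - s) powr (2 * gam)" using C0 st False by simp
    also have "\<dots> \<le> \<bar>C0\<bar> * ((t - s) powr gam * (t - s) powr gam)"
      by (simp add: powr_add[symmetric] mult_right_mono)
    also have "\<dots> \<le> \<bar>C0\<bar> * (T powr gam * (t - s) powr gam)"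
      using st gam by (intro mult_left_mono mult_right_mono powr_mono2) auto
    finally have "N (Young_rem Y z t s) \<le> \<bar>C0\<bar> * (T powr gam * (t - s) powr gam)" .
    moreover have "N (cdelta1 Y t s) \<le> N (Young_rem Y z t s) + K * Cx * (t - s) powr gam"
      using st K in_Y by (intro N_cdelta1_le_Young_rem) auto
    ultimately show ?thesis by (simp add: C1_def distrib_right mult.assoc)
  qed
  define C2 where "C2 = C1 * T powr gam"
  have b: "N (Y t) \<le> C2" if "0 \<le> t" "t \<le> T" for t
  proof -
    have "N (Y t) \<le> N (Y 0) + N (cdelta1 Y t 0)" using that in_Y T by (intro N_le_cdelta1) auto
    also have "\<dots> \<le> 0 + C1 * (t - 0) powr gam"
      using that a[of 0 t] Y by (simp add: is_Young_def)
    also have "\<dots> \<le> C2" unfolding C2_def using that gam C1 by (auto intro!: mult_left_mono powr_mono2)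
    finally show ?thesis .
  qed
  have C2: "0 \<le> C2" using C1 by (simp add: C2_def)
  show ?thesis
  proof (rule that)
    show "0 \<le> C1 + C2" using C1 C2 by simp
    show "N (cdelta1 Y t s) \<le> (C1 + C2) * (t - s) powr gam" if "0 \<le> s" "s \<le> t" "t \<le> T" for s t
      using a[OF that] C2 by (auto simp: distrib_right intro: add_increasing2)
    show "N (Y t) \<le> C1 + C2" if "0 \<le> t" "t \<le> T" for t using b[OF that] C1 by simp
    show "norm (phi_int (Y t) - phi_int (Y s)) \<le> (C1 + C2) * (t - s) powr gam"
      if "0 \<le> s" "s \<le> t" "t \<le> T" for s t
    proof -
      have "norm (phi_int (Y t) - phi_int (Y s)) \<le> N (cdelta1 Y t s) + (t - s) powr gam * N (Y s)"
        using that in_Y gam by (intro norm_phi_int_increment_le) auto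
      also have "\<dots> \<le> C1 * (t - s) powr gam + (t - s) powr gam * C2"
        using that by (intro add_mono a mult_left_mono b) auto
      finally show ?thesis by (simp add: algebra_simps)
    qed
  qed
qed

end

text \<open>\<open>\<sigma>_four\<close> makes composition with \<open>\<sigma>\<close> locally
  Lipschitz in Hoelder norm: applied to two paths at two times, it bounds the increment of the
  difference of the coefficients. The factor \<open>norm (a' - b')\<close> is where the Hoelder
  radius of one of the paths enters.\<close>

locale Young_equation = Young_driver phi gam T Cx X
  for phi gam T Cx and X :: "real \<Rightarrow> real \<Rightarrow> real^'d" +
  fixes a0 :: "real^'m" and \<sigma> :: "real^'m \<Rightarrow> real^'m^'d" and K :: real
  assumes \<sigma>_bound: "\<And>a. norm (\<sigma> a) \<le> K"
    and \<sigma>_lip: "\<And>a b. norm (\<sigma> a - \<sigma> b) \<le> K * norm (a - b)"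
    and \<sigma>_four: "\<And>a b a' b'. norm (\<sigma> a - \<sigma> b - (\<sigma> a' - \<sigma> b'))
      \<le> K * norm (a - b - (a' - b')) + K * (norm (a - a') + norm (b - b')) * norm (a' - b')"
begin

lemma K_nonneg: "0 \<le> K"
  using order_trans[OF norm_ge_zero \<sigma>_bound] .

definition coef :: "(real \<Rightarrow> real^'m) \<Rightarrow> real \<Rightarrow> real^'m^'d" where
  "coef w t = \<sigma> (a0 + w t)"

definition holder_le :: "real \<Rightarrow> real \<Rightarrow> (real \<Rightarrow> real^'m) \<Rightarrow> bool" where
  "holder_le e R w \<longleftrightarrow> (\<forall>s t. 0 \<le> s \<and> s \<le> t \<and> t \<le> T \<and> t - s \<le> e \<longrightarrow>
     norm (w t - w s) \<le> R * (t - s) powr gam)"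

text \<open>The exponential weight together with the restriction to increments of length at most \<open>e\<close>
  makes the solution map a contraction on all of \<open>[0, T]\<close>, so no patching of local solutions
  is needed.\<close>

definition dist_le :: "real \<Rightarrow> real \<Rightarrow> (real \<Rightarrow> real^'m) \<Rightarrow> (real \<Rightarrow> real^'m) \<Rightarrow> bool" where
  "dist_le e D w w' \<longleftrightarrow> (\<forall>s t. 0 \<le> s \<and> s \<le> t \<and> t \<le> T \<and> t - s \<le> e \<longrightarrow>
     norm (w t - w' t - (w s - w' s)) \<le> D * exp (t / e) * (t - s) powr gam)"

text \<open>The factor by which the solution map multiplies a distance, measured on convolutional
  increments. The \<open>2\<close> is the coefficient at the left end, estimated by
  \<open>dist_le_sup\<close>; the \<open>4\<close> adds that estimate at both ends of an increment
  in \<open>\<sigma>_four\<close>.\<close>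

definition rate :: "real \<Rightarrow> real \<Rightarrow> real" where
  "rate e R = e powr gam * Cx * K * (2 + Young_const * (1 + 4 * R * e powr gam))"

lemma holder_leD:
  "holder_le e R w \<Longrightarrow> 0 \<le> s \<Longrightarrow> s \<le> t \<Longrightarrow> t \<le> T \<Longrightarrow> t - s \<le> e \<Longrightarrow> norm (w t - w s) \<le> R * (t - s) powr gam"
  by (auto simp: holder_le_def)

lemma dist_leD:
  "dist_le e D w w' \<Longrightarrow> 0 \<le> s \<Longrightarrow> s \<le> t \<Longrightarrow> t \<le> T \<Longrightarrow> t - s \<le> e \<Longrightarrow>
    norm (w t - w' t - (w s - w' s)) \<le> D * exp (t / e) * (t - s) powr gam"
  by (auto simp: dist_le_def)

text \<open>Starting from equal values, the weighted Hoelder distance controls the uniform one with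
  a gain of \<open>e powr gam\<close>. This is one source of the smallness of
  \<open>rate\<close>.\<close>

lemma dist_le_sup:
  assumes "dist_le e D w w'" "0 < e" "0 \<le> D" "w 0 = w' 0" "0 \<le> t" "t \<le> T"
  shows "norm (w t - w' t) \<le> 2 * (D * e powr gam) * exp (t / e)"
proof (rule exp_growth[where T = T and f = "\<lambda>t. norm (w t - w' t)"])
  fix s t assume st: "0 \<le> s" "s \<le> t" "t \<le> T" "t - s \<le> e"
  have "norm (w t - w' t) \<le> norm (w s - w' s) + norm (w t - w' t - (w s - w' s))"
    by (rule norm_triangle_sub)
  also have "norm (w t - w' t - (w s - w' s)) \<le> D * exp (t / e) * (t - s) powr gam"
    by (rule dist_leD[OF assms(1) st])
  also have "\<dots> \<le> D * exp (t / e) * e powr gam"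
    using st assms gam by (intro mult_left_mono powr_mono2) auto
  finally show "norm (w t - w' t) \<le> norm (w s - w' s) + D * e powr gam * exp (t / e)"
    by (simp add: mult_ac)
qed (use assms in auto)

text \<open>Increments longer than \<open>e\<close> are handled by the boundedness of
  \<open>\<sigma>\<close>. The constant degenerates as \<open>e\<close> tends to 0, but it serves
  only to have the integral on the whole interval.\<close>

lemma coef_holder:
  assumes "holder_le e R w" "0 < e" "0 \<le> R" "0 \<le> p" "p \<le> q" "q \<le> T"
  shows "norm (coef w q - coef w p) \<le> (K * R + 2 * K / e powr gam) * (q - p) powr gam"
proof (cases "q - p \<le> e")
  case True
  have "norm (coef w q - coef w p) \<le> K * norm (w q - w p)"
    using \<sigma>_lip[of "a0 + w q" "a0 + w p"] by (simp add: coef_def)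
  also have "\<dots> \<le> K * (R * (q - p) powr gam)"
    using assms True K_nonneg by (intro mult_left_mono holder_leD) auto
  also have "\<dots> \<le> (K * R + 2 * K / e powr gam) * (q - p) powr gam"
    using K_nonneg by (simp add: distrib_right mult.assoc)
  finally show ?thesis .
next
  case False
  have "norm (coef w q - coef w p) \<le> 2 * K"
    using norm_triangle_ineq4[of "coef w q" "coef w p"] \<sigma>_bound[of "a0 + w q"] \<sigma>_bound[of "a0 + w p"]
    by (simp add: coef_def)
  also have "\<dots> = 2 * K / e powr gam * e powr gam" using assms by simp
  also have "\<dots> \<le> 2 * K / e powr gam * (q - p) powr gam"
    using False assms K_nonneg gam by (intro mult_left_mono powr_mono2) auto
  also have "\<dots> \<le> (K * R + 2 * K / e powr gam) * (q - p) powr gam"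
    using K_nonneg assms by (intro mult_right_mono) auto
  finally show ?thesis .
qed

lemma is_Young_coef_exists:
  assumes "holder_le e R w" "0 < e" "0 \<le> R"
  shows "\<exists>Y. is_Young (coef w) Y"
  by (rule Young_exists[OF _ coef_holder[OF assms]]) (use assms K_nonneg in auto)

text \<open>\<open>Q\<close> bounds convolutional increments of length at most \<open>e\<close>; its
  leading part \<open>Cx * K\<close> is free of \<open>R\<close> because \<open>\<sigma>\<close> is
  bounded. The other factor pays for passing to increments of \<open>phi_int\<close>: these involve
  \<open>N (Y s)\<close>, which \<open>linear_growth\<close> bounds by about \<open>T / e\<close>
  steps.\<close>

lemma solution_map_holder:
  assumes w: "holder_le e R w" and e: "0 < e" and R: "0 \<le> R" and Y: "is_Young (coef w) Y"
  defines "Q \<equiv> Cx * K * (1 + Young_const * R * e powr gam)"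
  shows "holder_le e (Q * (1 + e powr gam * (T / e + 1))) (\<lambda>t. phi_int (Y t))"
proof -
  note in_Y = is_Young_in[OF Y]
  have Q: "0 \<le> Q" using Cx K_nonneg R Young_const_pos by (simp add: Q_def)
  have inc: "N (cdelta1 Y t s) \<le> Q * (t - s) powr gam"
    if st: "0 \<le> s" "s \<le> t" "t \<le> T" "t - s \<le> e" for s t
  proof -
    have "N (cdelta1 Y t s) \<le> Cx * (K + Young_const * (K * R) * (t - s) powr gam) * (t - s) powr gam"
    proof (rule is_Young_increment_le[OF Y])
      show "norm (coef w s) \<le> K" by (simp add: coef_def \<sigma>_bound)
      fix p q assume pq: "s \<le> p" "p \<le> q" "q \<le> t"
      have "norm (coef w q - coef w p) \<le> K * norm (w q - w p)"
        using \<sigma>_lip[of "a0 + w q" "a0 + w p"] by (simp add: coef_def)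
      also have "\<dots> \<le> K * (R * (q - p) powr gam)"
        using pq st K_nonneg by (intro mult_left_mono holder_leD[OF w]) auto
      finally show "norm (coef w q - coef w p) \<le> K * R * (q - p) powr gam" by (simp add: mult.assoc)
    qed (use st K_nonneg R in auto)
    also have "\<dots> \<le> Cx * (K + Young_const * (K * R) * e powr gam) * (t - s) powr gam"
      using st Cx K_nonneg R Young_const_pos gam
      by (intro mult_right_mono mult_left_mono add_left_mono powr_mono2) auto
    finally show ?thesis by (simp add: Q_def algebra_simps)
  qed
  have bd: "N (Y t) \<le> Q * e powr gam * (T / e + 1)" if t: "0 \<le> t" "t \<le> T" for t
  proof -
    have "N (Y t) \<le> Q * e powr gam * (t / e + 1)"
    proof (rule linear_growth[where T = T and f = "\<lambda>t. N (Y t)"])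
      fix s t assume st: "0 \<le> s" "s \<le> t" "t \<le> T" "t - s \<le> e"
      have "N (Y t) \<le> N (Y s) + N (cdelta1 Y t s)" using st in_Y by (intro N_le_cdelta1) auto
      also have "N (cdelta1 Y t s) \<le> Q * (t - s) powr gam" by (rule inc[OF st])
      also have "\<dots> \<le> Q * e powr gam" using st Q gam by (intro mult_left_mono powr_mono2) auto
      finally show "N (Y t) \<le> N (Y s) + Q * e powr gam" by simp
    qed (use Y e Q t in \<open>auto simp: is_Young_def\<close>)
    also have "\<dots> \<le> Q * e powr gam * (T / e + 1)"
      using t e Q by (intro mult_left_mono) (auto simp: divide_right_mono)
    finally show ?thesis .
  qed
  show ?thesis
    unfolding holder_le_def
  proof safe
    fix s t assume st: "0 \<le> s" "s \<le> t" "t \<le> T" "t - s \<le> e"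
    have "norm (phi_int (Y t) - phi_int (Y s)) \<le> N (cdelta1 Y t s) + (t - s) powr gam * N (Y s)"
      using st in_Y gam by (intro norm_phi_int_increment_le) auto
    also have "\<dots> \<le> Q * (t - s) powr gam + (t - s) powr gam * (Q * e powr gam * (T / e + 1))"
      using st by (intro add_mono inc mult_left_mono bd) auto
    also have "\<dots> = Q * (1 + e powr gam * (T / e + 1)) * (t - s) powr gam"
      by (simp add: algebra_simps)
    finally show "norm (phi_int (Y t) - phi_int (Y s)) \<le> Q * (1 + e powr gam * (T / e + 1)) * (t - s) powr gam" .
  qed
qed

lemma coef_diff_holder:
  assumes w: "holder_le e R w'" and D: "dist_le e D w w'" and "0 < e" "0 \<le> R" "0 \<le> D" "w 0 = w' 0"
    and "0 \<le> p" "p \<le> q" "q \<le> T" "q - p \<le> e"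
  shows "norm (coef w q - coef w' q - (coef w p - coef w' p))
    \<le> D * exp (q / e) * K * (1 + 4 * R * e powr gam) * (q - p) powr gam"
proof -
  let ?E = "exp (q / e)" and ?d = "(q - p) powr gam"
  have "norm (w p - w' p) \<le> 2 * (D * e powr gam) * exp (p / e)"
    using assms by (intro dist_le_sup[OF D]) auto
  also have "\<dots> \<le> 2 * (D * e powr gam) * ?E"
    using assms by (intro mult_left_mono) (auto simp: divide_right_mono)
  finally have 1: "norm (w p - w' p) \<le> 2 * (D * e powr gam) * ?E" .
  have 2: "norm (w q - w' q) \<le> 2 * (D * e powr gam) * ?E"
    using assms by (intro dist_le_sup[OF D]) auto
  have 3: "norm (w q - w p - (w' q - w' p)) \<le> D * ?E * ?d"
    using dist_leD[OF D, of p q] assms by (simp add: algebra_simps)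
  have 4: "norm (w' q - w' p) \<le> R * ?d"
    using assms by (intro holder_leD[OF w]) auto
  have "norm (coef w q - coef w' q - (coef w p - coef w' p))
      \<le> K * norm (w q - w p - (w' q - w' p))
        + K * (norm (w q - w' q) + norm (w p - w' p)) * norm (w' q - w' p)"
    using \<sigma>_four[of "a0 + w q" "a0 + w p" "a0 + w' q" "a0 + w' p"]
    by (simp add: coef_def algebra_simps)
  also have "\<dots> \<le> K * (D * ?E * ?d)
      + K * (2 * (D * e powr gam) * ?E + 2 * (D * e powr gam) * ?E) * (R * ?d)"
    using 1 2 3 4 K_nonneg assms by (intro add_mono mult_mono mult_left_mono) auto
  also have "\<dots> = D * ?E * K * (1 + 4 * R * e powr gam) * ?d"
    by (simp add: algebra_simps)
  finally show ?thesis .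
qed

text \<open>The factor \<open>3\<close> is 1 for the convolutional increment of the difference and 2
  for its size at the left end, which \<open>norm_phi_int_increment_le\<close> adds; the latter uses
  \<open>exp_growth\<close> and \<open>e powr gam \<le> 1\<close>.\<close>

lemma solution_map_contraction:
  assumes w': "holder_le e R w'" and D: "dist_le e D w w'" and e: "0 < e" "e \<le> 1"
    and RD: "0 \<le> R" "0 \<le> D" and w0: "w 0 = w' 0"
    and Y: "is_Young (coef w) Y" and Y': "is_Young (coef w') Y'"
  shows "dist_le e (3 * rate e R * D) (\<lambda>t. phi_int (Y t)) (\<lambda>t. phi_int (Y' t))"
    and "\<And>t. 0 \<le> t \<Longrightarrow> t \<le> T \<Longrightarrow> N (\<lambda>\<xi>. Y t \<xi> - Y' t \<xi>) \<le> 2 * (rate e R * D * e powr gam) * exp (t / e)"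
proof -
  let ?Z = "\<lambda>t \<xi>. Y t \<xi> - Y' t \<xi>"
  define q where "q = rate e R"
  have q: "0 \<le> q" using RD Cx K_nonneg Young_const_pos by (simp add: q_def rate_def)
  have Z: "is_Young (\<lambda>t. coef w t - coef w' t) ?Z" by (rule is_Young_diff[OF Y Y'])
  note in_Z = is_Young_in[OF Z]
  have inc: "N (cdelta1 ?Z t s) \<le> q * D * exp (t / e) * (t - s) powr gam"
    if st: "0 \<le> s" "s \<le> t" "t \<le> T" "t - s \<le> e" for s t
  proof -
    let ?E = "exp (t / e)"
    let ?H = "D * ?E * K * (1 + 4 * R * e powr gam)"
    have H: "0 \<le> ?H" using RD K_nonneg by simp
    have "N (cdelta1 ?Z t s) \<le> Cx * (2 * K * D * e powr gam * ?E + Young_const * ?H * (t - s) powr gam) * (t - s) powr gam"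
    proof (rule is_Young_increment_le[OF Z st(1-3) H])
      have "norm (coef w s - coef w' s) \<le> K * norm (w s - w' s)"
        using \<sigma>_lip[of "a0 + w s" "a0 + w' s"] by (simp add: coef_def)
      also have "\<dots> \<le> K * (2 * (D * e powr gam) * exp (s / e))"
        using st e RD w0 K_nonneg by (intro mult_left_mono dist_le_sup[OF D]) auto
      also have "\<dots> \<le> K * (2 * (D * e powr gam) * ?E)"
        using st e RD K_nonneg by (intro mult_left_mono) (auto simp: divide_right_mono)
      finally show "norm (coef w s - coef w' s) \<le> 2 * K * D * e powr gam * ?E" by (simp add: mult_ac)
      fix p r assume pr: "s \<le> p" "p \<le> r" "r \<le> t"
      have "norm (coef w r - coef w' r - (coef w p - coef w' p))
          \<le> D * exp (r / e) * K * (1 + 4 * R * e powr gam) * (r - p) powr gam"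
        using pr st e RD w0 by (intro coef_diff_holder[OF w' D]) auto
      also have "\<dots> \<le> ?H * (r - p) powr gam"
        using pr e RD K_nonneg by (intro mult_right_mono mult_left_mono) (auto simp: divide_right_mono)
      finally show "norm (coef w r - coef w' r - (coef w p - coef w' p)) \<le> ?H * (r - p) powr gam" .
    qed
    also have "\<dots> \<le> Cx * (2 * K * D * e powr gam * ?E + Young_const * ?H * e powr gam) * (t - s) powr gam"
      using st Cx H Young_const_pos gam
      by (intro mult_right_mono mult_left_mono add_left_mono powr_mono2) auto
    also have "\<dots> = q * D * ?E * (t - s) powr gam" by (simp add: q_def rate_def algebra_simps)
    finally show ?thesis .
  qed
  have bd: "N (?Z t) \<le> 2 * (q * D * e powr gam) * exp (t / e)" if t: "0 \<le> t" "t \<le> T" for t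
  proof (rule exp_growth[where T = T and f = "\<lambda>t. N (?Z t)"])
    fix s t assume st: "0 \<le> s" "s \<le> t" "t \<le> T" "t - s \<le> e"
    have "N (?Z t) \<le> N (?Z s) + N (cdelta1 ?Z t s)" using st in_Z by (intro N_le_cdelta1) auto
    also have "N (cdelta1 ?Z t s) \<le> q * D * exp (t / e) * (t - s) powr gam" by (rule inc[OF st])
    also have "\<dots> \<le> q * D * exp (t / e) * e powr gam"
      using st q RD gam by (intro mult_left_mono powr_mono2) auto
    finally show "N (?Z t) \<le> N (?Z s) + q * D * e powr gam * exp (t / e)" by (simp add: mult_ac)
  qed (use Z e q RD t in \<open>auto simp: is_Young_def\<close>)
  show "N (?Z t) \<le> 2 * (rate e R * D * e powr gam) * exp (t / e)" if "0 \<le> t" "t \<le> T" for t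
    using bd[OF that] unfolding q_def .
  show "dist_le e (3 * rate e R * D) (\<lambda>t. phi_int (Y t)) (\<lambda>t. phi_int (Y' t))"
    unfolding dist_le_def q_def[symmetric]
  proof safe
    fix s t assume st: "0 \<le> s" "s \<le> t" "t \<le> T" "t - s \<le> e"
    let ?E = "exp (t / e)" and ?d = "(t - s) powr gam"
    have pd: "phi_int (Y r) - phi_int (Y' r) = phi_int (?Z r)" if "0 \<le> r" "r \<le> T" for r
      using that is_Young_in[OF Y] is_Young_in[OF Y'] by (simp add: phi_int_diff)
    have "norm (phi_int (?Z t) - phi_int (?Z s)) \<le> N (cdelta1 ?Z t s) + ?d * N (?Z s)"
      using st in_Z gam by (intro norm_phi_int_increment_le) auto
    also have "\<dots> \<le> q * D * ?E * ?d + ?d * (2 * (q * D * 1) * ?E)"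
    proof (intro add_mono inc[OF st] mult_left_mono)
      have "N (?Z s) \<le> 2 * (q * D * e powr gam) * exp (s / e)" using bd st by simp
      also have "\<dots> \<le> 2 * (q * D * 1) * ?E"
        using e q RD st gam powr_mono2[of gam e 1]
        by (intro mult_mono mult_left_mono) (auto simp: divide_right_mono)
      finally show "N (?Z s) \<le> 2 * (q * D * 1) * ?E" .
    qed simp
    also have "\<dots> = 3 * q * D * ?E * ?d" by (simp add: algebra_simps)
    finally show "norm (phi_int (Y t) - phi_int (Y' t) - (phi_int (Y s) - phi_int (Y' s))) \<le> 3 * q * D * ?E * ?d"
      using st by (simp add: pd)
  qed
qed

end

subsection \<open>Fixed point and uniqueness\<close>

lemma powr_tendsto_0_at_right:
  fixes p :: real
  assumes "0 < p"
  shows "((\<lambda>e. e powr p) \<longlongrightarrow> 0) (at_right 0)"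
  by (rule tendsto_zero_powrI[where b = p])
     (use assms in \<open>auto intro: tendsto_ident_at eventually_at_right_less[THEN eventually_mono]\<close>)

context Young_equation
begin

lemma rate_tendsto_0: "((\<lambda>e. rate e R) \<longlongrightarrow> 0) (at_right 0)"
proof -
  have "((\<lambda>e. rate e R) \<longlongrightarrow> 0 * Cx * K * (2 + Young_const * (1 + 4 * R * 0))) (at_right 0)"
    unfolding rate_def using gam by (intro tendsto_intros powr_tendsto_0_at_right) auto
  then show ?thesis by simp
qed

lemma dist_le_mono:
  assumes "dist_le e D w w'" "D \<le> D'"
  shows "dist_le e D' w w'"
  unfolding dist_le_def
proof safe
  fix s t assume "0 \<le> s" "s \<le> t" "t \<le> T" "t - s \<le> e"
  then have "norm (w t - w' t - (w s - w' s)) \<le> D * exp (t / e) * (t - s) powr gam"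
    by (rule dist_leD[OF assms(1)])
  also have "\<dots> \<le> D' * exp (t / e) * (t - s) powr gam"
    using assms(2) by (intro mult_right_mono) auto
  finally show "norm (w t - w' t - (w s - w' s)) \<le> D' * exp (t / e) * (t - s) powr gam" .
qed

lemma dist_le_trans:
  assumes "dist_le e D w w'" "dist_le e D' w' w''"
  shows "dist_le e (D + D') w w''"
  unfolding dist_le_def
proof safe
  fix s t assume st: "0 \<le> s" "s \<le> t" "t \<le> T" "t - s \<le> e"
  have "w t - w'' t - (w s - w'' s) = (w t - w' t - (w s - w' s)) + (w' t - w'' t - (w' s - w'' s))"
    by simp
  also have "norm \<dots> \<le> norm (w t - w' t - (w s - w' s)) + norm (w' t - w'' t - (w' s - w'' s))"
    by (rule norm_triangle_ineq)
  also have "\<dots> \<le> D * exp (t / e) * (t - s) powr gam + D' * exp (t / e) * (t - s) powr gam"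
    by (intro add_mono dist_leD[OF assms(1) st] dist_leD[OF assms(2) st])
  finally show "norm (w t - w'' t - (w s - w'' s)) \<le> (D + D') * exp (t / e) * (t - s) powr gam"
    by (simp add: distrib_right)
qed

lemma holder_le_dist_le:
  assumes "holder_le e R w" "holder_le e R w'" "0 < e" "0 \<le> R"
  shows "dist_le e (2 * R) w w'"
  unfolding dist_le_def
proof safe
  fix s t assume st: "0 \<le> s" "s \<le> t" "t \<le> T" "t - s \<le> e"
  have "w t - w' t - (w s - w' s) = (w t - w s) - (w' t - w' s)" by simp
  also have "norm \<dots> \<le> norm (w t - w s) + norm (w' t - w' s)" by (rule norm_triangle_ineq4)
  also have "\<dots> \<le> R * (t - s) powr gam + R * (t - s) powr gam"
    by (intro add_mono holder_leD[OF assms(1) st] holder_leD[OF assms(2) st])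
  also have "\<dots> = 2 * R * 1 * (t - s) powr gam" by simp
  also have "\<dots> \<le> 2 * R * exp (t / e) * (t - s) powr gam"
    using assms st by (intro mult_right_mono mult_left_mono) auto
  finally show "norm (w t - w' t - (w s - w' s)) \<le> 2 * R * exp (t / e) * (t - s) powr gam" .
qed

text \<open>Each solution's path is its own image under the solution map, so the contraction
  estimate can be applied repeatedly to the same pair, halving the bound on their distance each
  time.\<close>

theorem Young_solution_unique:
  assumes Y: "is_Young (coef (\<lambda>t. phi_int (Y t))) Y" and Y': "is_Young (coef (\<lambda>t. phi_int (Y' t))) Y'"
    and t: "0 \<le> t" "t \<le> T"
  shows "N (\<lambda>\<xi>. Y t \<xi> - Y' t \<xi>) = 0"
proof -
  let ?w = "\<lambda>t. phi_int (Y t)" and ?w' = "\<lambda>t. phi_int (Y' t)"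
  have bound: "norm (coef w t) \<le> K" for w t by (simp add: coef_def \<sigma>_bound)
  obtain C where C: "0 \<le> C" "\<And>s t. 0 \<le> s \<Longrightarrow> s \<le> t \<Longrightarrow> t \<le> T \<Longrightarrow> norm (?w t - ?w s) \<le> C * (t - s) powr gam"
    using is_Young_holder[OF Y bound] by metis
  obtain C' where C': "0 \<le> C'" "\<And>s t. 0 \<le> s \<Longrightarrow> s \<le> t \<Longrightarrow> t \<le> T \<Longrightarrow> norm (?w' t - ?w' s) \<le> C' * (t - s) powr gam"
    using is_Young_holder[OF Y' bound] by metis
  have w0: "?w 0 = ?w' 0" using is_Young_phi_int_0[OF Y] is_Young_phi_int_0[OF Y'] by simp
  define R where "R = C + C'"
  have R: "0 \<le> R" using C C' by (simp add: R_def)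
  \<comment> \<open>The Hoelder constants of the two paths hold for increments of every length.
    Hence \<open>R\<close> does not depend on \<open>e\<close>, and \<open>e\<close> may be chosen
    with \<open>rate e R\<close> small.\<close>
  have h: "holder_le e R ?w" "holder_le e R ?w'" for e
    using C C' by (auto simp: holder_le_def R_def distrib_right intro: add_increasing add_increasing2)
  have "\<forall>\<^sub>F e in at_right 0. rate e R < 1 / 6"
    using order_tendstoD(2)[OF rate_tendsto_0, of "1/6" R] by simp
  moreover have "\<forall>\<^sub>F e in at_right (0::real). 0 < e \<and> e < 1"
    using eventually_at_right_real[of 0 1] by simp
  ultimately have "\<forall>\<^sub>F e in at_right (0::real). rate e R < 1 / 6 \<and> 0 < e \<and> e < 1"
    by eventually_elim simp
  then obtain e where e: "rate e R < 1 / 6" "0 < e" "e < 1"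
    using eventually_happens[of _ "at_right (0::real)"] by auto
  have D: "dist_le e (2 * R / 2 ^ n) ?w ?w'" for n
  proof (induction n)
    case 0
    then show ?case using holder_le_dist_le[OF h e(2) R] by simp
  next
    case (Suc n)
    let ?D = "2 * R / 2 ^ n"
    have "dist_le e (3 * rate e R * ?D) ?w ?w'"
      using Suc e R Y Y' w0
      by (intro solution_map_contraction(1)[OF h(2)]) auto
    moreover have "3 * rate e R * ?D \<le> 1 / 2 * ?D"
      using e R by (intro mult_right_mono) auto
    ultimately show ?case using dist_le_mono by fastforce
  qed
  have "N (\<lambda>\<xi>. Y t \<xi> - Y' t \<xi>) \<le> 2 * (rate e R * (2 * R / 2 ^ n) * e powr gam) * exp (t / e)" for n
    using D[of n] e R Y Y' w0 t
    by (intro solution_map_contraction(2)[OF h(2)]) auto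
  moreover have "(\<lambda>n. 2 * (rate e R * (2 * R / 2 ^ n) * e powr gam) * exp (t / e))
      \<longlonglongrightarrow> 2 * (rate e R * 0 * e powr gam) * exp (t / e)"
    by (intro tendsto_intros LIMSEQ_divide_realpow_zero) auto
  ultimately have "N (\<lambda>\<xi>. Y t \<xi> - Y' t \<xi>) \<le> 2 * (rate e R * 0 * e powr gam) * exp (t / e)"
    by (intro LIMSEQ_le_const) auto
  then show ?thesis using N_nonneg by (intro antisym) auto
qed

text \<open>The Hoelder ball of radius \<open>R = c e powr (\<gamma> - 1)\<close> on scale \<open>e\<close> is invariant for small \<open>e\<close>, and
  \<open>R e\<^sup>\<gamma> = c e powr (2 \<gamma> - 1)\<close> still tends to 0 because \<open>\<gamma> > 1/2\<close>.\<close>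

lemma invariant_ball_exists:
  obtains e R where "0 < e" "e \<le> 1" "0 \<le> R" "3 * rate e R \<le> 1 / 2"
    "Cx * K * (1 + Young_const * R * e powr gam) * (1 + e powr gam * (T / e + 1)) \<le> R"
proof -
  \<comment> \<open>Chosen so that \<open>(2 + T) * Cx * K \<le> c / 2\<close>. This absorbs the
    part of the invariance inequality that is free of \<open>R\<close>; the part proportional to
    \<open>R\<close> fits into the other half of \<open>c\<close> once \<open>e\<close> is
    small.\<close>
  define c where "c = 2 * (2 + T) * Cx * K + 1"
  have c: "0 \<le> c" using T Cx K_nonneg by (simp add: c_def)
  let ?p = "2 * gam - 1"
  let ?r = "\<lambda>e. e powr gam * Cx * K * (2 + Young_const * (1 + 4 * c * e powr ?p))"
  have "(?r \<longlongrightarrow> 0 * Cx * K * (2 + Young_const * (1 + 4 * c * 0))) (at_right 0)"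
    using gam by (intro tendsto_intros powr_tendsto_0_at_right) auto
  then have "\<forall>\<^sub>F e in at_right 0. ?r e < 1 / 6"
    using order_tendstoD(2)[of ?r 0 "at_right 0" "1/6"] by simp
  moreover have "((\<lambda>e. (2 + T) * Cx * K * Young_const * e powr ?p) \<longlongrightarrow> (2 + T) * Cx * K * Young_const * 0) (at_right 0)"
    using gam by (intro tendsto_intros powr_tendsto_0_at_right) auto
  then have "\<forall>\<^sub>F e in at_right 0. (2 + T) * Cx * K * Young_const * e powr ?p < 1 / 2"
    using order_tendstoD(2)[of "\<lambda>e. (2 + T) * Cx * K * Young_const * e powr ?p" 0 "at_right 0" "1/2"] by simp
  moreover have "\<forall>\<^sub>F e in at_right (0::real). 0 < e \<and> e < 1"
    using eventually_at_right_real[of 0 1] by simp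
  ultimately have "\<forall>\<^sub>F e in at_right (0::real). ?r e < 1 / 6 \<and>
      (2 + T) * Cx * K * Young_const * e powr ?p < 1 / 2 \<and> 0 < e \<and> e < 1"
    by eventually_elim simp
  then obtain e where e: "?r e < 1 / 6" "(2 + T) * Cx * K * Young_const * e powr ?p < 1 / 2" "0 < e" "e < 1"
    using eventually_happens[of _ "at_right (0::real)"] by auto
  define R where "R = c * e powr (gam - 1)"
  have Re: "R * e powr gam = c * e powr ?p"
    by (simp add: R_def powr_add[symmetric])
  have R: "0 \<le> R" using c by (simp add: R_def)
  have "rate e R = ?r e" by (simp add: rate_def mult.assoc Re)
  then have 1: "3 * rate e R \<le> 1 / 2" using e by simp
  let ?g = "e powr (gam - 1)"
  have g1: "1 \<le> ?g" using e gam powr_mono'[of "gam - 1" 0 e] by simp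
  have "e powr gam \<le> 1" using e gam powr_mono2[of gam e 1] by simp
  moreover have "e powr gam * (T / e) = T * ?g" using e by (simp add: powr_diff)
  ultimately have "1 + e powr gam * (T / e + 1) \<le> 2 + T * ?g" by (simp add: distrib_left)
  also have "\<dots> \<le> (2 + T) * ?g" using g1 by (simp add: distrib_right)
  finally have f: "1 + e powr gam * (T / e + 1) \<le> (2 + T) * ?g" .
  have "Cx * K * (1 + Young_const * R * e powr gam) * (1 + e powr gam * (T / e + 1))
      \<le> Cx * K * (1 + Young_const * R * e powr gam) * ((2 + T) * ?g)"
    using f Cx K_nonneg Young_const_pos R by (intro mult_left_mono) auto
  also have "\<dots> = ((2 + T) * Cx * K + ((2 + T) * Cx * K * Young_const * e powr ?p) * c) * ?g"
  proof -
    have "Young_const * R * e powr gam = Young_const * (c * e powr ?p)" by (simp add: mult.assoc Re)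
    then show ?thesis by (simp only:) (simp add: algebra_simps)
  qed
  also have "\<dots> \<le> (c / 2 + 1 / 2 * c) * ?g"
  proof (intro mult_right_mono add_mono)
    show "(2 + T) * Cx * K \<le> c / 2" by (simp add: c_def algebra_simps)
  qed (use e c in auto)
  also have "\<dots> = R" by (simp add: R_def)
  finally show ?thesis using that[of e R] e R 1 by simp
qed

theorem Young_solution_exists: "\<exists>Y. is_Young (coef (\<lambda>t. phi_int (Y t))) Y"
proof -
  obtain e R where e: "0 < e" "e \<le> 1" and R: "0 \<le> R" and rate: "3 * rate e R \<le> 1 / 2"
    and inv: "Cx * K * (1 + Young_const * R * e powr gam) * (1 + e powr gam * (T / e + 1)) \<le> R"
    by (rule invariant_ball_exists)
  \<comment> \<open>Integrals are determined only up to null functions, so a representative is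
    chosen. Outside the Hoelder ball the value may be arbitrary; every fact about
    \<open>\<Phi>\<close> below assumes membership in the ball.\<close>
  define sol where "sol w = (SOME Y. is_Young (coef w) Y)" for w
  define \<Phi> where "\<Phi> w t = phi_int (sol w t)" for w t
  have sol: "is_Young (coef w) (sol w)" if "holder_le e R w" for w
    unfolding sol_def by (rule someI_ex[OF is_Young_coef_exists[OF that e(1) R]])
  have \<Phi>_holder: "holder_le e R (\<Phi> w)" if "holder_le e R w" for w
  proof -
    have "holder_le e (Cx * K * (1 + Young_const * R * e powr gam) * (1 + e powr gam * (T / e + 1))) (\<Phi> w)"
      using solution_map_holder[OF that e(1) R sol[OF that]] by (simp add: \<Phi>_def[abs_def])
    then show ?thesis
      unfolding holder_le_def by (meson inv mult_right_mono order_trans powr_ge_zero)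
  qed
  have \<Phi>_0: "\<Phi> w 0 = 0" if "holder_le e R w" for w
    using is_Young_phi_int_0[OF sol[OF that]] by (simp add: \<Phi>_def)
  have \<Phi>_dist: "dist_le e (D / 2) (\<Phi> w) (\<Phi> w')"
    if "holder_le e R w" "holder_le e R w'" "dist_le e D w w'" "0 \<le> D" "w 0 = w' 0" for w w' D
  proof -
    have "dist_le e (3 * rate e R * D) (\<Phi> w) (\<Phi> w')"
      using solution_map_contraction(1)[OF that(2,3) e R that(4,5) sol[OF that(1)] sol[OF that(2)]]
      by (simp add: \<Phi>_def[abs_def])
    then show ?thesis by (rule dist_le_mono) (use mult_right_mono[OF rate that(4)] in simp)
  qed
  define W where "W n = (\<Phi> ^^ n) (\<lambda>_. 0)" for n
  have W_Suc: "W (Suc n) = \<Phi> (W n)" for n by (simp add: W_def)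
  have W_holder: "holder_le e R (W n)" for n
  proof (induction n)
    case 0
    then show ?case using R by (simp add: W_def holder_le_def)
  qed (simp add: W_Suc \<Phi>_holder)
  have W_0: "W n 0 = 0" for n
    by (cases n) (simp_all add: W_Suc \<Phi>_0 W_holder, simp add: W_def)
  have W_dist: "dist_le e (2 * R / 2 ^ n) (W (Suc n)) (W n)" for n
  proof (induction n)
    case 0
    then show ?case using holder_le_dist_le[OF W_holder W_holder e(1) R] by simp
  next
    case (Suc n)
    have "dist_le e (2 * R / 2 ^ n / 2) (\<Phi> (W (Suc n))) (\<Phi> (W n))"
      using Suc R W_holder W_0 by (intro \<Phi>_dist) auto
    then show ?case by (simp add: W_Suc mult.commute)
  qed
  \<comment> \<open>The geometric sum of the terms \<open>2 * R / 2 ^ j\<close> for \<open>j\<close>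
    from \<open>n\<close> to \<open>n + k - 1\<close>, kept in closed form so that the induction on
    \<open>k\<close> goes through.\<close>
  have W_dist': "dist_le e (4 * R / 2 ^ n - 4 * R / 2 ^ (n + k)) (W (n + k)) (W n)" for n k
  proof (induction k)
    case 0
    then show ?case by (simp add: dist_le_def)
  next
    case (Suc k)
    have "dist_le e (2 * R / 2 ^ (n + k) + (4 * R / 2 ^ n - 4 * R / 2 ^ (n + k))) (W (Suc (n + k))) (W n)"
      by (rule dist_le_trans[OF W_dist Suc])
    moreover have "2 * R / 2 ^ (n + k) + (4 * R / 2 ^ n - 4 * R / 2 ^ (n + k))
        = 4 * R / 2 ^ n - 4 * R / 2 ^ (n + Suc k)"
      by (simp add: field_simps)
    ultimately show ?case by simp
  qed
  define E where "E t = 2 * e powr gam * exp (t / e)" for t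
  \<comment> \<open>Pointwise limits suffice: \<open>holder_le\<close> and \<open>dist_le\<close>
    consist of inequalities between finitely many values of the paths, so both pass to the
    limit.\<close>
  have lim_ex: "\<exists>l. (\<lambda>n. W n t) \<longlonglongrightarrow> l" if t: "0 \<le> t" "t \<le> T" for t
  proof -
    have le: "norm (W (Suc n) t - W n t) \<le> 2 * R * E t * (1 / 2) ^ n" for n
      using dist_le_sup[OF W_dist e(1) _ _ t, of n] R W_0 by (simp add: E_def field_simps power_one_over)
    have "summable (\<lambda>n. W (Suc n) t - W n t)"
      by (rule summable_comparison_test'[where g = "\<lambda>n. 2 * R * E t * (1 / 2) ^ n" and N = 0])
         (use le in auto)
    then have "(\<lambda>n. \<Sum>k<n. W (Suc k) t - W k t) \<longlonglongrightarrow> (\<Sum>k. W (Suc k) t - W k t)"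
      by (rule summable_LIMSEQ)
    then have "(\<lambda>n. W n t - W 0 t) \<longlonglongrightarrow> (\<Sum>k. W (Suc k) t - W k t)"
      by (simp only: sum_lessThan_telescope[of "\<lambda>k. W k t"])
    from tendsto_add[OF this tendsto_const[of "W 0 t"]] show ?thesis by auto
  qed
  then obtain w where w: "\<And>t. 0 \<le> t \<Longrightarrow> t \<le> T \<Longrightarrow> (\<lambda>n. W n t) \<longlonglongrightarrow> w t" by metis
  have w_0: "w 0 = 0" using LIMSEQ_unique[OF w[of 0]] W_0 T by simp
  have w_holder: "holder_le e R w"
    unfolding holder_le_def
  proof safe
    fix s t assume st: "0 \<le> s" "s \<le> t" "t \<le> T" "t - s \<le> e"
    have "(\<lambda>n. norm (W n t - W n s)) \<longlonglongrightarrow> norm (w t - w s)"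
      using st by (intro tendsto_intros w) auto
    then show "norm (w t - w s) \<le> R * (t - s) powr gam"
      by (rule LIMSEQ_le_const2) (use holder_leD[OF W_holder st] in auto)
  qed
  have w_dist: "dist_le e (4 * R / 2 ^ n) w (W n)" for n
    unfolding dist_le_def
  proof safe
    fix s t assume st: "0 \<le> s" "s \<le> t" "t \<le> T" "t - s \<le> e"
    have d: "dist_le e (4 * R / 2 ^ n) (W (n + k)) (W n)" for k
      by (rule dist_le_mono[OF W_dist']) (use R in simp)
    have shift: "(\<lambda>k. W (n + k) r) \<longlonglongrightarrow> w r" if "0 \<le> r" "r \<le> T" for r
      using LIMSEQ_ignore_initial_segment[OF w[OF that], of n] by (simp add: add.commute)
    have "(\<lambda>k. norm (W (n + k) t - W n t - (W (n + k) s - W n s)))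
        \<longlonglongrightarrow> norm (w t - W n t - (w s - W n s))"
      using st by (intro tendsto_intros shift) auto
    then show "norm (w t - W n t - (w s - W n s)) \<le> 4 * R / 2 ^ n * exp (t / e) * (t - s) powr gam"
      by (rule LIMSEQ_le_const2) (use dist_leD[OF d st] in auto)
  qed
  \<comment> \<open>The sequence \<open>W (Suc n) = \<Phi> (W n)\<close> tends to \<open>w\<close>
    by construction and to \<open>\<Phi> w\<close> by the contraction.\<close>
  have fixp: "\<Phi> w t = w t" if t: "0 \<le> t" "t \<le> T" for t
  proof (rule LIMSEQ_unique)
    show "(\<lambda>n. W (Suc n) t) \<longlonglongrightarrow> w t" using w[OF t] by (rule LIMSEQ_Suc)
    have "norm (W (Suc n) t - \<Phi> w t) \<le> 2 * R * E t / 2 ^ n" for n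
    proof -
      have "dist_le e (4 * R / 2 ^ n / 2) (\<Phi> w) (\<Phi> (W n))"
        using R w_dist w_holder W_holder W_0 w_0 by (intro \<Phi>_dist) auto
      from dist_le_sup[OF this e(1) _ _ t] R \<Phi>_0[OF w_holder] \<Phi>_0[OF W_holder]
      show ?thesis by (simp add: W_Suc norm_minus_commute E_def field_simps)
    qed
    then show "(\<lambda>n. W (Suc n) t) \<longlonglongrightarrow> \<Phi> w t"
      by (intro LIM_zero_cancel[OF Lim_null_comparison[OF _ LIMSEQ_divide_realpow_zero[of 2 "2 * R * E t"]]]) auto
  qed
  have "is_Young (coef (\<lambda>t. phi_int (sol w t))) (sol w)"
    using sol[OF w_holder]
    by (subst is_Young_cong[of _ "coef w"]) (use fixp in \<open>auto simp: coef_def \<Phi>_def\<close>)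
  then show ?thesis by blast
qed

end

subsection \<open>Solutions in the sense of sewing\<close>

context Young_driver
begin

text \<open>Strong continuity of the exponential semigroup, by dominated convergence: for
  \<open>\<xi> > 0\<close> both exponentials lie between 0 and 1. For a general \<open>g\<close>
  there is no rate.\<close>

lemma exp_translation_tendsto:
  assumes g: "in_L g" and u: "\<And>n. r \<le> u n" and lim: "u \<longlonglongrightarrow> s" and r: "r \<le> s"
  shows "(\<lambda>n. N (\<lambda>\<xi>. exp (- \<xi> * (u n - r)) *\<^sub>R g \<xi> - exp (- \<xi> * (s - r)) *\<^sub>R g \<xi>)) \<longlonglongrightarrow> 0"
proof -
  let ?c = "\<lambda>n \<xi>. \<bar>exp (- \<xi> * (u n - r)) - exp (- \<xi> * (s - r))\<bar>"
  have eq: "N (\<lambda>\<xi>. exp (- \<xi> * (u n - r)) *\<^sub>R g \<xi> - exp (- \<xi> * (s - r)) *\<^sub>R g \<xi>)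
      = (LINT \<xi>|lborel. ?c n \<xi> * (wt \<xi> * norm (g \<xi>)))" for n
    unfolding N_eq scaleR_diff_left[symmetric] norm_scaleR by (simp add: mult_ac)
  have int: "integrable lborel (\<lambda>\<xi>. wt \<xi> * norm (g \<xi>))" using g by (simp add: in_L_iff)
  then have [measurable]: "(\<lambda>\<xi>. wt \<xi> * norm (g \<xi>)) \<in> borel_measurable borel"
    using borel_measurable_integrable by fastforce
  have "(\<lambda>n. LINT \<xi>|lborel. ?c n \<xi> * (wt \<xi> * norm (g \<xi>))) \<longlonglongrightarrow> (LINT (\<xi>::real)|lborel. (0::real))"
  proof (rule integral_dominated_convergence[where w = "\<lambda>\<xi>. 1 * (wt \<xi> * norm (g \<xi>))"])
    have "(\<lambda>n. ?c n \<xi> * (wt \<xi> * norm (g \<xi>)))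
        \<longlonglongrightarrow> \<bar>exp (- \<xi> * (s - r)) - exp (- \<xi> * (s - r))\<bar> * (wt \<xi> * norm (g \<xi>))" for \<xi>
      by (intro tendsto_intros lim)
    then show "AE \<xi> in lborel. (\<lambda>n. ?c n \<xi> * (wt \<xi> * norm (g \<xi>))) \<longlonglongrightarrow> 0" by simp
    have "norm (?c n \<xi> * (wt \<xi> * norm (g \<xi>))) \<le> 1 * (wt \<xi> * norm (g \<xi>))" for n \<xi>
    proof (cases "0 < \<xi>")
      case True
      have "0 < exp (- \<xi> * d)" "exp (- \<xi> * d) \<le> 1" if "0 \<le> d" for d using True that by auto
      from this[of "u n - r"] this[of "s - r"] have "?c n \<xi> \<le> 1" using u[of n] r by linarith
      then have "?c n \<xi> * (wt \<xi> * norm (g \<xi>)) \<le> 1 * (wt \<xi> * norm (g \<xi>))"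
        by (rule mult_right_mono) simp
      then show ?thesis by (simp add: abs_mult)
    qed (simp add: wt_def)
    then show "AE \<xi> in lborel. norm (?c n \<xi> * (wt \<xi> * norm (g \<xi>))) \<le> 1 * (wt \<xi> * norm (g \<xi>))" for n
      by simp
  qed (use int in auto)
  then show ?thesis unfolding eq by simp
qed

text \<open>A small convolutional increment does not make the ordinary one small, since
  \<open>(1 - exp (- \<xi> * d)) *\<^sub>R Y s \<xi>\<close> has no rate in this norm. Both times
  are therefore compared with a common earlier time \<open>r\<close>: the increments from
  \<open>r\<close> are small by the Hoelder bound, and the semigroup acts on the fixed function
  \<open>Y r\<close>, where strong continuity applies.\<close>

lemma L_continuous_of_holder:
  assumes Y: "\<And>t. 0 \<le> t \<Longrightarrow> t \<le> T \<Longrightarrow> in_L (Y t)"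
    and C: "0 \<le> C" "\<And>s t. 0 \<le> s \<Longrightarrow> s \<le> t \<Longrightarrow> t \<le> T \<Longrightarrow> N (cdelta1 Y t s) \<le> C * (t - s) powr gam"
    and s: "0 \<le> s" "s \<le> T"
  shows "((\<lambda>t. N (\<lambda>\<xi>. Y t \<xi> - Y s \<xi>)) \<longlongrightarrow> 0) (at s within {0..T})"
  unfolding tendsto_at_iff_sequentially comp_def
proof (intro allI impI LIMSEQ_I)
  fix u :: "nat \<Rightarrow> real" and \<epsilon> :: real
  assume u: "\<forall>n. u n \<in> {0..T} - {s}" and lim: "u \<longlonglongrightarrow> s" and \<epsilon>: "0 < \<epsilon>"
  have "((\<lambda>d. C * (d powr gam * 2 powr gam) + C * d powr gam) \<longlongrightarrow> C * (0 * 2 powr gam) + C * 0) (at_right 0)"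
    using gam by (intro tendsto_intros powr_tendsto_0_at_right) auto
  then have "\<forall>\<^sub>F d in at_right 0. C * (d powr gam * 2 powr gam) + C * d powr gam < \<epsilon> / 2"
    using \<epsilon> by (intro order_tendstoD) auto
  moreover have "\<forall>\<^sub>F d in at_right (0::real). 0 < d" by (rule eventually_at_right_less)
  ultimately have "\<forall>\<^sub>F d in at_right (0::real). C * (d powr gam * 2 powr gam) + C * d powr gam < \<epsilon> / 2 \<and> 0 < d"
    by eventually_elim simp
  then obtain d where d: "C * (d powr gam * 2 powr gam) + C * d powr gam < \<epsilon> / 2" "0 < d"
    using eventually_happens[of _ "at_right (0::real)"] by auto
  define r where "r = max 0 (s - d)"
  have r: "0 \<le> r" "r \<le> s" "s - r \<le> d" "r \<le> T" using s d by (auto simp: r_def)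
  \<comment> \<open>Strong continuity is stated for times not before \<open>r\<close>; eventually
    \<open>u n\<close> is such a time and equals \<open>v n\<close>.\<close>
  define v where "v n = max r (u n)" for n
  have "v \<longlonglongrightarrow> max r s" unfolding v_def by (intro tendsto_intros lim)
  then have v: "v \<longlonglongrightarrow> s" using r by (simp add: max_absorb2)
  let ?e = "\<lambda>n. N (\<lambda>\<xi>. exp (- \<xi> * (v n - r)) *\<^sub>R Y r \<xi> - exp (- \<xi> * (s - r)) *\<^sub>R Y r \<xi>)"
  have "?e \<longlonglongrightarrow> 0" using r by (intro exp_translation_tendsto Y v) (auto simp: v_def)
  then have "\<forall>\<^sub>F n in sequentially. ?e n < \<epsilon> / 2" using \<epsilon> by (intro order_tendstoD) auto
  moreover have "\<forall>\<^sub>F n in sequentially. dist (u n) s < d" using lim d(2) by (rule tendstoD)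
  ultimately have "\<forall>\<^sub>F n in sequentially. norm (N (\<lambda>\<xi>. Y (u n) \<xi> - Y s \<xi>) - 0) < \<epsilon>"
  proof eventually_elim
    case (elim n)
    have un: "0 \<le> u n" "u n \<le> T" using u by auto
    have ru: "r \<le> u n" "u n - r \<le> 2 * d" using elim un s d by (auto simp: r_def dist_real_def)
    then have vn: "v n = u n" by (simp add: v_def)
    let ?a = "\<lambda>\<xi>. exp (- \<xi> * (u n - r)) *\<^sub>R Y r \<xi> - exp (- \<xi> * (s - r)) *\<^sub>R Y r \<xi>"
    let ?b = "\<lambda>\<xi>. cdelta1 Y (u n) r \<xi> - cdelta1 Y s r \<xi>"
    have a: "in_L ?a" using r ru Y by (intro L_diff(1) L_exp(1)) auto
    have b: "in_L ?b" "N ?b \<le> N (cdelta1 Y (u n) r) + N (cdelta1 Y s r)"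
      using r ru un s Y by (auto intro!: L_diff L_cdelta1)
    have "(\<lambda>\<xi>. Y (u n) \<xi> - Y s \<xi>) = (\<lambda>\<xi>. ?b \<xi> + ?a \<xi>)" by (auto simp: cdelta1_def)
    then have "N (\<lambda>\<xi>. Y (u n) \<xi> - Y s \<xi>) \<le> N (cdelta1 Y (u n) r) + N (cdelta1 Y s r) + N ?a"
      using L_add(2)[OF b(1) a] b(2) by simp
    also have "N (cdelta1 Y (u n) r) \<le> C * (2 * d) powr gam"
    proof -
      have "N (cdelta1 Y (u n) r) \<le> C * (u n - r) powr gam" using C(2) r ru un by simp
      also have "\<dots> \<le> C * (2 * d) powr gam" using C(1) ru gam by (intro mult_left_mono powr_mono2) auto
      finally show ?thesis .
    qed
    also have "N (cdelta1 Y s r) \<le> C * d powr gam"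
    proof -
      have "N (cdelta1 Y s r) \<le> C * (s - r) powr gam" using C(2) r s by simp
      also have "\<dots> \<le> C * d powr gam" using C(1) r gam by (intro mult_left_mono powr_mono2) auto
      finally show ?thesis .
    qed
    also have "C * (2 * d) powr gam = C * (d powr gam * 2 powr gam)"
      using d by (simp add: powr_mult mult.commute)
    finally show ?case using d(1) elim(1) unfolding vn by simp
  qed
  then show "\<exists>n0. \<forall>n\<ge>n0. norm (N (\<lambda>\<xi>. Y (u n) \<xi> - Y s \<xi>) - 0) < \<epsilon>"
    by (simp add: eventually_sequentially)
qed

lemma is_Young_C1_space:
  assumes Y: "is_Young z Y" and K: "\<And>t. norm (z t) \<le> K"
  shows "C1_space phi gam T Y"
proof -
  obtain C where C: "0 \<le> C"
    "\<And>s t. 0 \<le> s \<Longrightarrow> s \<le> t \<Longrightarrow> t \<le> T \<Longrightarrow> N (cdelta1 Y t s) \<le> C * (t - s) powr gam"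
    "\<And>t. 0 \<le> t \<Longrightarrow> t \<le> T \<Longrightarrow> N (Y t) \<le> C"
    using is_Young_holder[OF Y K] by metis
  note in_Y = is_Young_in[OF Y]
  show ?thesis
    unfolding C1_space_def
  proof (intro conjI ballI)
    show "in_L (Y s)" if "s \<in> {0..T}" for s using in_Y that by simp
    show "((\<lambda>t. N (\<lambda>\<xi>. Y t \<xi> - Y s \<xi>)) \<longlongrightarrow> 0) (at s within {0..T})" if "s \<in> {0..T}" for s
      using that by (intro L_continuous_of_holder[OF in_Y C(1,2)]) auto
    show "\<exists>C. \<forall>s\<in>{0..T}. N (Y s) \<le> C" using C(3) by (intro exI[of _ C]) auto
    show "\<exists>C. \<forall>s t. 0 \<le> s \<and> s < t \<and> t \<le> T \<longrightarrow> N (cdelta1 Y t s) \<le> C * (t - s) powr gam"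
      using C(2) by (auto intro!: exI[of _ C])
  qed
qed

lemma C1_space_phi_int_holder:
  assumes Y: "C1_space phi gam T Y"
  obtains C where "0 \<le> C"
    "\<And>s t. 0 \<le> s \<Longrightarrow> s \<le> t \<Longrightarrow> t \<le> T \<Longrightarrow> norm (phi_int (Y t) - phi_int (Y s)) \<le> C * (t - s) powr gam"
proof -
  have in_Y: "\<And>t. 0 \<le> t \<Longrightarrow> t \<le> T \<Longrightarrow> in_L (Y t)" using Y by (simp add: C1_space_def)
  obtain C1 where C1: "\<And>t. 0 \<le> t \<Longrightarrow> t \<le> T \<Longrightarrow> N (Y t) \<le> C1"
    using Y unfolding C1_space_def by (meson atLeastAtMost_iff)
  obtain C2 where C2: "\<And>s t. 0 \<le> s \<Longrightarrow> s < t \<Longrightarrow> t \<le> T \<Longrightarrow> N (cdelta1 Y t s) \<le> C2 * (t - s) powr gam"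
    using Y unfolding C1_space_def by blast
  have C1_nonneg: "0 \<le> C1" using C1[of 0] T order_trans[OF N_nonneg] by fastforce
  show ?thesis
  proof (rule that)
    show "0 \<le> \<bar>C2\<bar> + C1" using C1_nonneg by simp
    fix s t assume st: "0 \<le> s" "s \<le> t" "t \<le> T"
    show "norm (phi_int (Y t) - phi_int (Y s)) \<le> (\<bar>C2\<bar> + C1) * (t - s) powr gam"
    proof (cases "s = t")
      case False
      have "norm (phi_int (Y t) - phi_int (Y s)) \<le> N (cdelta1 Y t s) + (t - s) powr gam * N (Y s)"
        using st in_Y gam by (intro norm_phi_int_increment_le) auto
      also have "\<dots> \<le> \<bar>C2\<bar> * (t - s) powr gam + (t - s) powr gam * C1"
      proof (intro add_mono mult_left_mono)
        have "N (cdelta1 Y t s) \<le> C2 * (t - s) powr gam" using C2 st False by simp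
        also have "\<dots> \<le> \<bar>C2\<bar> * (t - s) powr gam" by (intro mult_right_mono) auto
        finally show "N (cdelta1 Y t s) \<le> \<bar>C2\<bar> * (t - s) powr gam" .
      qed (use st C1 in auto)
      finally show ?thesis by (simp add: algebra_simps)
    qed simp
  qed
qed

section \<open>Equivalence of the remainder and the sewing formulations\<close>

lemma N_vector_matrix_null:
  assumes "in_L g" "N g = 0"
  shows "N (\<lambda>\<xi>. g \<xi> v* (A :: real^'m^'d)) = 0"
  using L_vector_matrix(2)[OF assms(1), of A] assms(2) N_nonneg by (intro antisym) auto

text \<open>Replacing \<open>X\<close> by \<open>x1\<close> changes the remainder by a null
  function, so the exponent \<open>2 * gam\<close> survives. The deviation from the prescribed
  defect is \<open>cdelta2 x1 t u s \<xi> v* z s\<close> up to sign, which is null.\<close>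

lemma is_Young_sewing:
  assumes x1: "\<And>s t. 0 \<le> s \<Longrightarrow> s \<le> t \<Longrightarrow> t \<le> T \<Longrightarrow> in_L (x1 t s)"
    and x1_X: "\<And>s t. 0 \<le> s \<Longrightarrow> s \<le> t \<Longrightarrow> t \<le> T \<Longrightarrow> N (\<lambda>\<xi>. cdelta1 X t s \<xi> - x1 t s \<xi>) = 0"
    and x1_delta: "\<And>s u t. 0 \<le> s \<Longrightarrow> s \<le> u \<Longrightarrow> u \<le> t \<Longrightarrow> t \<le> T \<Longrightarrow> N (cdelta2 x1 t u s) = 0"
    and Y: "is_Young z Y"
  defines "B \<equiv> \<lambda>t s \<xi>. cdelta1 Y t s \<xi> - x1 t s \<xi> v* z s"
  shows "is_sewing phi gam T (\<lambda>t u s \<xi>. x1 t u \<xi> v* (z u - z s)) B"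
proof -
  note in_Y = is_Young_in[OF Y]
  obtain C where C: "\<And>s t. 0 \<le> s \<Longrightarrow> s < t \<Longrightarrow> t \<le> T \<Longrightarrow> N (Young_rem Y z t s) \<le> C * (t - s) powr (2 * gam)"
    using Y by (auto simp: is_Young_def)
  have B_in: "in_L (B t s)" if "0 \<le> s" "s \<le> t" "t \<le> T" for s t
    unfolding B_def using that in_Y x1 by (intro L_diff(1) L_cdelta1 L_vector_matrix(1)) auto
  have B_le: "N (B t s) \<le> C * (t - s) powr (2 * gam)" if st: "0 \<le> s" "s < t" "t \<le> T" for s t
  proof -
    have d: "in_L (\<lambda>\<xi>. cdelta1 X t s \<xi> - x1 t s \<xi>)" using st x1 by (intro L_diff(1) X_delta_in) auto
    have "B t s = (\<lambda>\<xi>. Young_rem Y z t s \<xi> + (cdelta1 X t s \<xi> - x1 t s \<xi>) v* z s)"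
      by (auto simp: B_def Young_rem_def vector_matrix_mult_diff_rdistrib)
    moreover have "N (\<lambda>\<xi>. Young_rem Y z t s \<xi> + (cdelta1 X t s \<xi> - x1 t s \<xi>) v* z s)
        \<le> N (Young_rem Y z t s) + N (\<lambda>\<xi>. (cdelta1 X t s \<xi> - x1 t s \<xi>) v* z s)"
      using st in_Y by (intro L_add(2) Young_rem_in L_vector_matrix(1) d) auto
    moreover have "N (\<lambda>\<xi>. (cdelta1 X t s \<xi> - x1 t s \<xi>) v* z s) = 0"
      using st by (intro N_vector_matrix_null[OF d] x1_X) auto
    ultimately show ?thesis using C[OF st] by simp
  qed
  have "N (\<lambda>\<xi>. cdelta2 B t u s \<xi> - x1 t u \<xi> v* (z u - z s)) = 0"
    if st: "0 \<le> s" "s \<le> u" "u \<le> t" "t \<le> T" for s u t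
  proof -
    have d: "in_L (cdelta2 x1 t u s)"
      unfolding cdelta2_def[abs_def] using st x1 by (intro L_diff(1) L_exp(1)) auto
    have "cdelta2 B t u s \<xi> - x1 t u \<xi> v* (z u - z s) = - (cdelta2 x1 t u s \<xi> v* z s)" for \<xi>
      unfolding B_def cdelta2_def cdelta1_split[of Y t s \<xi> u]
      by (simp add: vector_matrix_mult_diff_rdistrib vector_matrix_mult_diff_distrib
          scaleR_vector_matrix_assoc scaleR_diff_right)
    then show ?thesis
      using N_vector_matrix_null[OF d x1_delta[OF st], of "z s"]
        L_uminus(2)[OF L_vector_matrix(1)[OF d, of "z s"]] by simp
  qed
  moreover have "\<exists>\<mu>>1. \<exists>C. \<forall>s t. 0 \<le> s \<and> s < t \<and> t \<le> T \<longrightarrow> N (B t s) \<le> C * (t - s) powr \<mu>"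
    using B_le gam by (intro exI[of _ "2 * gam"] conjI exI[of _ C]) auto
  ultimately show ?thesis unfolding is_sewing_def using B_in by blast
qed

text \<open>A sewing element comes with some exponent \<open>\<mu> > 1\<close>;
  \<open>Young_rem_bound\<close> upgrades it to \<open>2 * gam\<close> by the Hoelder continuity of
  \<open>z\<close>.\<close>

lemma sewing_is_Young:
  assumes x1: "\<And>s t. 0 \<le> s \<Longrightarrow> s \<le> t \<Longrightarrow> t \<le> T \<Longrightarrow> in_L (x1 t s)"
    and x1_X: "\<And>s t. 0 \<le> s \<Longrightarrow> s \<le> t \<Longrightarrow> t \<le> T \<Longrightarrow> N (\<lambda>\<xi>. cdelta1 X t s \<xi> - x1 t s \<xi>) = 0"
    and Y: "\<And>t. 0 \<le> t \<Longrightarrow> t \<le> T \<Longrightarrow> in_L (Y t)" "N (Y 0) = 0"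
    and H: "0 \<le> H"
    and z: "\<And>p q. 0 \<le> p \<Longrightarrow> p \<le> q \<Longrightarrow> q \<le> T \<Longrightarrow> norm (z q - z p) \<le> H * (q - p) powr gam"
    and B: "is_sewing phi gam T h B"
    and eq: "\<And>s t. 0 \<le> s \<Longrightarrow> s \<le> t \<Longrightarrow> t \<le> T \<Longrightarrow>
      N (\<lambda>\<xi>. cdelta1 Y t s \<xi> - (x1 t s \<xi> v* z s + B t s \<xi>)) = 0"
  shows "is_Young z Y"
proof -
  have B_in: "\<And>s t. 0 \<le> s \<Longrightarrow> s \<le> t \<Longrightarrow> t \<le> T \<Longrightarrow> in_L (B t s)"
    using B by (simp add: is_sewing_def)
  obtain \<mu> C where \<mu>: "1 < \<mu>"
    and C: "\<And>s t. 0 \<le> s \<Longrightarrow> s < t \<Longrightarrow> t \<le> T \<Longrightarrow> N (B t s) \<le> C * (t - s) powr \<mu>"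
    using B unfolding is_sewing_def by blast
  have rem: "N (Young_rem Y z t s) \<le> C * (t - s) powr \<mu>" if st: "0 \<le> s" "s < t" "t \<le> T" for s t
  proof -
    let ?a = "\<lambda>\<xi>. cdelta1 Y t s \<xi> - (x1 t s \<xi> v* z s + B t s \<xi>)"
    let ?b = "\<lambda>\<xi>. (cdelta1 X t s \<xi> - x1 t s \<xi>) v* z s"
    have d: "in_L (\<lambda>\<xi>. cdelta1 X t s \<xi> - x1 t s \<xi>)" using st x1 by (intro L_diff(1) X_delta_in) auto
    have a: "in_L ?a"
      using st x1 Y B_in by (intro L_diff(1) L_add(1) L_cdelta1 L_vector_matrix(1)) auto
    have b: "in_L ?b" by (rule L_vector_matrix(1)[OF d])
    have b0: "N ?b = 0" using st by (intro N_vector_matrix_null[OF d] x1_X) auto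
    have ab: "in_L (\<lambda>\<xi>. ?a \<xi> - ?b \<xi>)" "N (\<lambda>\<xi>. ?a \<xi> - ?b \<xi>) \<le> N ?a + N ?b"
      by (rule L_diff[OF a b])+
    have "Young_rem Y z t s = (\<lambda>\<xi>. (?a \<xi> - ?b \<xi>) + B t s \<xi>)"
      by (auto simp: Young_rem_def vector_matrix_mult_diff_rdistrib)
    moreover have "N (\<lambda>\<xi>. (?a \<xi> - ?b \<xi>) + B t s \<xi>) \<le> N (\<lambda>\<xi>. ?a \<xi> - ?b \<xi>) + N (B t s)"
      using st by (intro L_add(2) ab(1) B_in) auto
    moreover have "N ?a = 0" using eq st by simp
    ultimately show ?thesis using ab(2) b0 C[OF st] by simp
  qed
  have "N (Young_rem Y z t s) \<le> Young_const * Cx * H * (t - s) powr (2 * gam)"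
    if "0 \<le> s" "s < t" "t \<le> T" for s t
    using that by (intro Young_rem_bound[OF Y(1) rem \<mu> H z]) auto
  then show ?thesis unfolding is_Young_def using Y by auto
qed

end

text \<open>The third estimate is the mean value inequality for the difference of \<open>f\<close>
  along the segments from \<open>b\<close> to \<open>a\<close> and from \<open>b'\<close> to
  \<open>a'\<close>. Its derivative is \<open>Df\<close> at one point applied to
  \<open>a - b - (a' - b')\<close>, plus a difference of \<open>Df\<close> at two points applied to
  \<open>a' - b'\<close>; the bound on the second derivative controls the latter.\<close>

lemma C2_bounded_estimates:
  fixes f :: "'a::euclidean_space \<Rightarrow> 'b::euclidean_space"
  assumes "C2_bounded f"
  obtains K where "\<And>a. norm (f a) \<le> K" "\<And>a b. norm (f a - f b) \<le> K * norm (a - b)"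
    "\<And>a b a' b'. norm (f a - f b - (f a' - f b'))
      \<le> K * norm (a - b - (a' - b')) + K * (norm (a - a') + norm (b - b')) * norm (a' - b')"
proof -
  obtain Df D2f K where Df: "\<And>a. (f has_derivative blinfun_apply (Df a)) (at a)"
    and D2f: "\<And>a. (Df has_derivative blinfun_apply (D2f a)) (at a)"
    and K: "\<And>a. norm (f a) \<le> K" "\<And>a. norm (Df a) \<le> K" "\<And>a. norm (D2f a) \<le> K"
    using assms unfolding C2_bounded_def by blast
  have K0: "0 \<le> K" using order_trans[OF norm_ge_zero K(1)] .
  have lip: "norm (f a - f b) \<le> K * norm (a - b)" for a b
    by (rule differentiable_bound[of UNIV f "\<lambda>a. blinfun_apply (Df a)"])
       (use Df K(2) in \<open>auto simp: norm_blinfun.rep_eq[symmetric] has_derivative_at_withinI\<close>)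
  have lip': "norm (Df a - Df b) \<le> K * norm (a - b)" for a b
    by (rule differentiable_bound[of UNIV Df "\<lambda>a. blinfun_apply (D2f a)"])
       (use D2f K(3) in \<open>auto simp: norm_blinfun.rep_eq[symmetric] has_derivative_at_withinI\<close>)
  have four: "norm (f a - f b - (f a' - f b'))
      \<le> K * norm (a - b - (a' - b')) + K * (norm (a - a') + norm (b - b')) * norm (a' - b')"
    (is "_ \<le> ?M") for a b a' b'
  proof -
    let ?p = "\<lambda>\<theta>::real. b + \<theta> *\<^sub>R (a - b)" and ?p' = "\<lambda>\<theta>::real. b' + \<theta> *\<^sub>R (a' - b')"
    let ?\<psi> = "\<lambda>\<theta>. f (?p \<theta>) - f (?p' \<theta>)"
    let ?d = "\<lambda>\<theta> h. blinfun_apply (Df (?p \<theta>)) (h *\<^sub>R (a - b)) - blinfun_apply (Df (?p' \<theta>)) (h *\<^sub>R (a' - b'))"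
    have der: "(?\<psi> has_derivative ?d \<theta>) (at \<theta> within {0..1})" for \<theta>
    proof -
      have p: "(?p has_derivative (\<lambda>h. h *\<^sub>R (a - b))) (at \<theta> within {0..1})"
        and p': "(?p' has_derivative (\<lambda>h. h *\<^sub>R (a' - b'))) (at \<theta> within {0..1})"
        by (auto intro!: derivative_eq_intros)
      show ?thesis
        by (intro has_derivative_diff has_derivative_compose[OF p Df] has_derivative_compose[OF p' Df])
    qed
    have on: "onorm (?d \<theta>) \<le> ?M" if "\<theta> \<in> {0..1}" for \<theta>
    proof (rule onorm_le)
      fix h :: real
      \<comment> \<open>Corresponding points of the two segments are no farther apart than the sum
        of the distances of their ends, uniformly in the parameter.\<close>
      have "?p \<theta> - ?p' \<theta> = \<theta> *\<^sub>R (a - a') + (1 - \<theta>) *\<^sub>R (b - b')" by (simp add: algebra_simps)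
      also have "norm \<dots> \<le> \<theta> * norm (a - a') + (1 - \<theta>) * norm (b - b')"
        using that by (intro order_trans[OF norm_triangle_ineq]) auto
      also have "\<dots> \<le> 1 * norm (a - a') + 1 * norm (b - b')"
        using that by (intro add_mono mult_right_mono) auto
      finally have pp: "norm (?p \<theta> - ?p' \<theta>) \<le> norm (a - a') + norm (b - b')" by simp
      let ?v = "blinfun_apply (Df (?p \<theta>)) (a - b - (a' - b'))"
      let ?v' = "blinfun_apply (Df (?p \<theta>) - Df (?p' \<theta>)) (a' - b')"
      have "?d \<theta> h = h *\<^sub>R (?v + ?v')"
        by (simp add: blinfun.bilinear_simps algebra_simps)
      moreover have "norm ?v \<le> K * norm (a - b - (a' - b'))"
        using norm_blinfun mult_right_mono[OF K(2) norm_ge_zero] by (rule order_trans)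
      moreover have "norm ?v' \<le> K * (norm (a - a') + norm (b - b')) * norm (a' - b')"
      proof -
        have "norm ?v' \<le> norm (Df (?p \<theta>) - Df (?p' \<theta>)) * norm (a' - b')" by (rule norm_blinfun)
        also have "\<dots> \<le> (K * norm (?p \<theta> - ?p' \<theta>)) * norm (a' - b')"
          by (intro mult_right_mono lip') simp
        also have "\<dots> \<le> (K * (norm (a - a') + norm (b - b'))) * norm (a' - b')"
          by (intro mult_right_mono mult_left_mono pp K0) simp
        finally show ?thesis .
      qed
      ultimately have "norm (?d \<theta> h) \<le> \<bar>h\<bar> * ?M"
        by (simp only: norm_scaleR) (intro mult_left_mono order_trans[OF norm_triangle_ineq] add_mono, auto)
      then show "norm (?d \<theta> h) \<le> ?M * norm h" by (simp add: mult.commute)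
    qed
    have "norm (?\<psi> 1 - ?\<psi> 0) \<le> ?M * norm (1 - 0 :: real)"
      by (rule differentiable_bound[of "{0..1}" ?\<psi> ?d]) (use der on in auto)
    moreover have "?\<psi> 1 - ?\<psi> 0 = f a - f b - (f a' - f b')" by simp
    ultimately show ?thesis by (simp only:) simp
  qed
  show ?thesis by (rule that[OF K(1) lip four])
qed

theorem theorem3p10:
  fixes phi :: "real \<Rightarrow> real" and gam T :: real
    and x :: "real \<Rightarrow> real^'d"
    and x1 :: "real \<Rightarrow> real \<Rightarrow> real \<Rightarrow> real^'d"
    and a0 :: "real^'m" and \<sigma> :: "real^'m \<Rightarrow> real^'m^'d"
  assumes "phi \<in> borel_measurable lborel"
    and "1/2 < gam" and "gam < 1" and "0 < T"
    and "holder_on gam {0..T} x"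
    and "C2_space phi gam T x1"
    and "\<forall>s u t. 0 \<le> s \<and> s \<le> u \<and> u \<le> t \<and> t \<le> T \<longrightarrow> NLg phi gam (cdelta2 x1 t u s) = 0"
    and "C2_bounded \<sigma>"
  shows "\<exists>y. C1_space phi gam T y \<and> is_solution phi gam T x1 a0 \<sigma> y \<and>
           (\<forall>y'. C1_space phi gam T y' \<and> is_solution phi gam T x1 a0 \<sigma> y' \<longrightarrow>
                (\<forall>t\<in>{0..T}. NLg phi gam (\<lambda>\<xi>. y' t \<xi> - y t \<xi>) = 0))"
proof -
  interpret Lg_space phi gam using assms(1) by unfold_locales simp
  define X where "X t = x1 t 0" for t
  have x1: "in_L (x1 t s)" if "0 \<le> s" "s \<le> t" "t \<le> T" for s t
    using assms(6) that by (simp add: C2_space_def)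
  obtain C where C: "\<And>s t. 0 \<le> s \<Longrightarrow> s < t \<Longrightarrow> t \<le> T \<Longrightarrow> N (x1 t s) \<le> C * (t - s) powr gam"
    using assms(6) unfolding C2_space_def by blast
  have x1_delta: "N (cdelta2 x1 t u s) = 0" if "0 \<le> s" "s \<le> u" "u \<le> t" "t \<le> T" for s u t
    using assms(7) that by blast
  have X_in: "in_L (X t)" if "0 \<le> t" "t \<le> T" for t using x1 that by (simp add: X_def)
  have x1_X: "N (\<lambda>\<xi>. cdelta1 X t s \<xi> - x1 t s \<xi>) = 0" if "0 \<le> s" "s \<le> t" "t \<le> T" for s t
  proof -
    have "(\<lambda>\<xi>. cdelta1 X t s \<xi> - x1 t s \<xi>) = cdelta2 x1 t s 0"
      by (auto simp: cdelta1_def cdelta2_def X_def)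
    then show ?thesis using x1_delta[of 0 s t] that by simp
  qed
  have X_le: "N (cdelta1 X t s) \<le> \<bar>C\<bar> * (t - s) powr gam" if st: "0 \<le> s" "s \<le> t" "t \<le> T" for s t
  proof (cases "s = t")
    case True
    then have "cdelta1 X t s = (\<lambda>\<xi>. 0)" by (auto simp: cdelta1_def)
    then show ?thesis by simp
  next
    case False
    have "N (\<lambda>\<xi>. (cdelta1 X t s \<xi> - x1 t s \<xi>) + x1 t s \<xi>) \<le> N (\<lambda>\<xi>. cdelta1 X t s \<xi> - x1 t s \<xi>) + N (x1 t s)"
      using st x1 X_in by (intro L_add(2) L_diff(1) L_cdelta1) auto
    then have "N (cdelta1 X t s) \<le> N (x1 t s)" using x1_X[OF st] by simp
    also have "\<dots> \<le> C * (t - s) powr gam" using C st False by simp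
    also have "\<dots> \<le> \<bar>C\<bar> * (t - s) powr gam" by (intro mult_right_mono) auto
    finally show ?thesis .
  qed
  obtain K where K: "\<And>a. norm (\<sigma> a) \<le> K" "\<And>a b. norm (\<sigma> a - \<sigma> b) \<le> K * norm (a - b)"
    "\<And>a b a' b'. norm (\<sigma> a - \<sigma> b - (\<sigma> a' - \<sigma> b'))
      \<le> K * norm (a - b - (a' - b')) + K * (norm (a - a') + norm (b - b')) * norm (a' - b')"
    using C2_bounded_estimates[OF assms(8)] by metis
  interpret Young_equation phi gam T "\<bar>C\<bar>" X a0 \<sigma> K
    by unfold_locales (use assms(2-4) X_in X_le K in auto)
  let ?z = "\<lambda>y. coef (\<lambda>t. phi_int (y t))"
  have z_eq: "?z y = (\<lambda>u. \<sigma> (a0 + (LINT \<eta>:{0<..}|lborel. phi \<eta> *\<^sub>R y u \<eta>)))" for y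
    by (simp add: fun_eq_iff coef_def phi_int_def)
  have coef_bound: "norm (coef w t) \<le> K" for w t by (simp add: coef_def K)
  have solution_Young: "is_Young (?z y) y"
    if y: "C1_space phi gam T y" and sol: "is_solution phi gam T x1 a0 \<sigma> y" for y
  proof -
    obtain B where B: "N (y 0) = 0" "is_sewing phi gam T (\<lambda>t u s \<xi>. x1 t u \<xi> v* (?z y u - ?z y s)) B"
      "\<And>s t. 0 \<le> s \<Longrightarrow> s \<le> t \<Longrightarrow> t \<le> T \<Longrightarrow>
         N (\<lambda>\<xi>. cdelta1 y t s \<xi> - (x1 t s \<xi> v* ?z y s + B t s \<xi>)) = 0"
      using sol unfolding is_solution_def Let_def z_eq[symmetric] by blast
    \<comment> \<open>Being a solution does not by itself state that the coefficient is Hoelder;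
      this comes from membership in the path space, through \<open>phi_int\<close> and the Lipschitz
      bound on \<open>\<sigma>\<close>.\<close>
    obtain H where H: "0 \<le> H" "\<And>s t. 0 \<le> s \<Longrightarrow> s \<le> t \<Longrightarrow> t \<le> T \<Longrightarrow>
        norm (phi_int (y t) - phi_int (y s)) \<le> H * (t - s) powr gam"
      using C1_space_phi_int_holder[OF y] by metis
    have "norm (?z y q - ?z y p) \<le> (K * H) * (q - p) powr gam" if "0 \<le> p" "p \<le> q" "q \<le> T" for p q
    proof -
      have "norm (?z y q - ?z y p) \<le> K * norm (phi_int (y q) - phi_int (y p))"
        using K(2)[of "a0 + phi_int (y q)" "a0 + phi_int (y p)"] by (simp add: coef_def)
      also have "\<dots> \<le> K * (H * (q - p) powr gam)"
        using H(2)[OF that] K_nonneg by (intro mult_left_mono)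
      finally show ?thesis by (simp add: mult.assoc)
    qed
    then show ?thesis
      using y K_nonneg H(1)
      by (intro sewing_is_Young[OF x1 x1_X _ B(1) _ _ B(2,3), where H = "K * H"]) (auto simp: C1_space_def)
  qed
  obtain Y where Y: "is_Young (?z Y) Y" using Young_solution_exists by blast
  have "is_solution phi gam T x1 a0 \<sigma> Y"
    unfolding is_solution_def Let_def z_eq[symmetric]
  proof (intro conjI exI)
    show "N (Y 0) = 0" using Y by (simp add: is_Young_def)
    show "is_sewing phi gam T (\<lambda>t u s \<xi>. x1 t u \<xi> v* (?z Y u - ?z Y s))
        (\<lambda>t s \<xi>. cdelta1 Y t s \<xi> - x1 t s \<xi> v* ?z Y s)"
      by (rule is_Young_sewing[OF x1 x1_X x1_delta Y])
  qed simp
  moreover have "C1_space phi gam T Y" by (rule is_Young_C1_space[OF Y coef_bound])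
  moreover have "N (\<lambda>\<xi>. y' t \<xi> - Y t \<xi>) = 0"
    if "C1_space phi gam T y'" "is_solution phi gam T x1 a0 \<sigma> y'" "t \<in> {0..T}" for y' t
    using Young_solution_unique[OF solution_Young[OF that(1,2)] Y] that(3) by simp
  ultimately show ?thesis by blast
qed

end
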